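(* Let $d,p\in\mathbb{N}$ (both $\ge 1$), $\mu\in\mathbb{R}$ and $T>0$. Let $r>d/2$ and $0<\gamma\le 1$. Assume that the exact solution $v$ of $$i\partial_t v(t)=\mu\,\mathrm{e}^{-it\Delta}\Big[\big\vert\mathrm{e}^{it\Delta}v(t)\big\vert^{2p}\,\mathrm{e}^{it\Delta}v(t)\Big]$$ satisfies $v(t)\in H^{r+\gamma}(\mathbb{T}^d)$ for $0\le t\le T$. For a step size $\tau>0$ let $t_n=n\tau$, $v^0=v(0)$ and $$v^{n+1}=v^n-i\mu\tau\,\mathrm{e}^{-it_n\Delta}\left[\left(\mathrm{e}^{it_n\Delta}v^n\right)^{p+1}\left(\varphi_1(-2i\tau\Delta)\left(\mathrm{e}^{-it_n\Delta}\overline{v^n}\right)^{p}\right)\right],\qquad n\ge 0.$$ Then there exists a constant $\tau_0>0$ such that for all step sizes $\tau\le\tau_0$ and all $t_n\le T$, $$\Vert v(t_n)-v^n\Vert_r\le c\,\tau^\gamma,$$ where $c$ depends on $\sup_{0\le t\le T}\Vert v(t)\Vert_{r+\gamma}$.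
   Context: $\mathbb{T}^d$ is the $d$-dimensional torus (period $2\pi$ in each coordinate), functions are complex-valued with Fourier expansion $f(x)=\sum_{\mathbf{k}\in\mathbb{Z}^d}\hat f_{\mathbf{k}}\mathrm{e}^{i\mathbf{k}\cdot\mathbf{x}}$, and $\Delta=\sum_{k=1}^d\partial_{x_k}^2$. $\Vert\cdot\Vert_r$ denotes the standard Sobolev norm of $H^r=H^r(\mathbb{T}^d)$, $\Vert f\Vert_r^2=\sum_{\mathbf{k}}(1+|\mathbf{k}|)^{2r}|\hat f_{\mathbf{k}}|^2$. Functions of $\Delta$ act as Fourier multipliers: $\mathrm{e}^{it\Delta}$ multiplies $\hat f_{\mathbf{k}}$ by $\mathrm{e}^{-it|\mathbf{k}|^2}$. With $\varphi_1(z)=(\mathrm{e}^z-1)/z$, extended by $\varphi_1(0)=1$, the operator $\varphi_1(-2i\tau\Delta)$ multiplies $\hat f_{\mathbf{k}}$ by $\varphi_1(2i\tau|\mathbf{k}|^2)$. The exact solution is understood in the mild sense, $$v(t)=v(0)-i\mu\int_0^t\mathrm{e}^{-is\Delta}\Big[\big|\mathrm{e}^{is\Delta}v(s)\big|^{2p}\mathrm{e}^{is\Delta}v(s)\Big]\mathrm{d}s,$$ with finite supremum $\sup_{0\le t\le T}\Vert v(t)\Vert_{r+\gamma}$. The constant $c$ may additionally depend on $r,d,p,\gamma,\mu,T$, but neither $c$ nor $\tau_0$ depends on $\tau$ or $n$. *)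

theory Defs
  imports "HOL-Analysis.Analysis"
begin

text \<open>Functions on the torus are \<open>2\<pi>\<close>-periodic functions on \<open>real ^ 'd\<close>; as usual an element of
  a Lebesgue or Sobolev space is represented by any member of its a.e.-equivalence class.\<close>

definition periodic :: "(real ^ 'd \<Rightarrow> complex) \<Rightarrow> bool" where
  "periodic f \<longleftrightarrow> (\<forall>x i. f (x + axis i (2 * pi)) = f x)"

definition torus_cell :: "(real ^ 'd) set" where
  "torus_cell = cbox 0 (\<chi> i. 2 * pi)"

definition freq :: "int ^ 'd \<Rightarrow> real ^ 'd" where
  "freq k = (\<chi> i. real_of_int (k $ i))"

definition fourier_coeff :: "(real ^ 'd \<Rightarrow> complex) \<Rightarrow> int ^ 'd \<Rightarrow> complex" where
  "fourier_coeff f k =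
     (LINT x:torus_cell|lborel. f x * cis (- (freq k \<bullet> x))) / of_real ((2 * pi) ^ CARD('d))"

definition torus_L2 :: "(real ^ 'd \<Rightarrow> complex) set" where
  "torus_L2 = {f. periodic f \<and> f \<in> borel_measurable borel \<and>
                  set_integrable lborel torus_cell (\<lambda>x. (cmod (f x))\<^sup>2)}"

definition sobolev_space :: "real \<Rightarrow> (real ^ 'd \<Rightarrow> complex) set" where
  "sobolev_space r = {f \<in> torus_L2.
     (\<lambda>k. (1 + norm (freq k)) powr (2 * r) * (cmod (fourier_coeff f k))\<^sup>2) summable_on UNIV}"

text \<open>Only meaningful on \<open>sobolev_space r\<close>: \<open>infsum\<close> of a divergent series is \<open>0\<close>.\<close>

definition sobolev_norm :: "real \<Rightarrow> (real ^ 'd \<Rightarrow> complex) \<Rightarrow> real" where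
  "sobolev_norm r f =
     sqrt (\<Sum>\<^sub>\<infinity>k. (1 + norm (freq k)) powr (2 * r) * (cmod (fourier_coeff f k))\<^sup>2)"

text \<open>\<open>laplace_fun g\<close> is the operator \<open>g(\<Delta>)\<close>; the symbol of \<open>\<Delta>\<close> is \<open>- |k|\<^sup>2\<close>. For bounded \<open>g\<close> and \<open>f\<close>
  in \<open>sobolev_space r\<close> with \<open>r > d/2\<close>, the only case of interest here, the series converges
  absolutely for every \<open>x\<close> and yields the continuous representative.\<close>

definition laplace_fun ::
  "(real \<Rightarrow> complex) \<Rightarrow> (real ^ 'd \<Rightarrow> complex) \<Rightarrow> real ^ 'd \<Rightarrow> complex" where
  "laplace_fun g f x =
     (\<Sum>\<^sub>\<infinity>k. g (- (norm (freq k))\<^sup>2) * fourier_coeff f k * cis (freq k \<bullet> x))"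

definition schroedinger_group :: "real \<Rightarrow> (real ^ 'd \<Rightarrow> complex) \<Rightarrow> real ^ 'd \<Rightarrow> complex" where
  "schroedinger_group t = laplace_fun (\<lambda>z. exp (\<i> * of_real t * of_real z))"

definition phi1 :: "complex \<Rightarrow> complex" where
  "phi1 z = (if z = 0 then 1 else (exp z - 1) / z)"

definition phi1_op :: "real \<Rightarrow> (real ^ 'd \<Rightarrow> complex) \<Rightarrow> real ^ 'd \<Rightarrow> complex" where
  "phi1_op \<tau> = laplace_fun (\<lambda>z. phi1 (- 2 * \<i> * of_real \<tau> * of_real z))"

definition twisted_nonlinearity ::
  "nat \<Rightarrow> real \<Rightarrow> (real ^ 'd \<Rightarrow> complex) \<Rightarrow> real ^ 'd \<Rightarrow> complex" where
  "twisted_nonlinearity p s u =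
     schroedinger_group (- s)
       (\<lambda>y. of_real (cmod (schroedinger_group s u y) ^ (2 * p)) * schroedinger_group s u y)"

text \<open>The time integral of the function-valued integrand is taken pointwise in \<open>x\<close>, and the
  equation is one between a.e.-classes. Point evaluations being continuous on \<open>H\<^sup>r\<close> for
  \<open>r > d/2\<close>, a solution with the Bochner integral in \<open>H\<^sup>r\<close> is a solution in this sense.\<close>

definition mild_solution ::
  "nat \<Rightarrow> real \<Rightarrow> real \<Rightarrow> (real \<Rightarrow> real ^ 'd \<Rightarrow> complex) \<Rightarrow> bool" where
  "mild_solution p \<mu> T v \<longleftrightarrow>
     (\<forall>t\<in>{0..T}. AE x in lborel.
        set_integrable lborel {0..t} (\<lambda>s. twisted_nonlinearity p s (v s) x) \<and>
        v t x = v 0 x - \<i> * of_real \<mu> * (LINT s:{0..t}|lborel. twisted_nonlinearity p s (v s) x))"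

primrec low_reg_scheme ::
  "nat \<Rightarrow> real \<Rightarrow> real \<Rightarrow> (real ^ 'd \<Rightarrow> complex) \<Rightarrow> nat \<Rightarrow> real ^ 'd \<Rightarrow> complex" where
  "low_reg_scheme p \<mu> \<tau> v0 0 = v0"
| "low_reg_scheme p \<mu> \<tau> v0 (Suc n) =
     (let t = real n * \<tau>; w = low_reg_scheme p \<mu> \<tau> v0 n in
      (\<lambda>x. w x - \<i> * of_real \<mu> * of_real \<tau> *
         schroedinger_group (- t)
           (\<lambda>y. schroedinger_group t w y ^ (p + 1) *
                phi1_op \<tau> (\<lambda>z. schroedinger_group (- t) (\<lambda>u. cnj (w u)) z ^ p) y) x))"

end

theory Submission
  imports Defs
begin

text \<open>
Every operator in the problem is a Fourier multiplier, a conjugation or a product, so the proof is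
carried out on Fourier coefficients. There the \<open>H\<^sup>r\<close> norm is a weighted \<open>l\<^sup>2\<close> norm, a product is a convolution,
and \<open>e\<^bsup>it\<Delta>\<^esup>\<close> is the isometry \<open>flow t\<close>. For \<open>r > d/2\<close> the embedding of \<open>H\<^sup>r\<close> into \<open>l\<^sup>1\<close> makes \<open>H\<^sup>r\<close> an algebra
(\<open>sobolev_conv_bound\<close>), which bounds the nonlinearity and makes it locally Lipschitz.

The reason for the order \<open>\<gamma>\<close> at the cost of only \<open>\<gamma>\<close> derivatives is the identity
\<open>|k|\<^sup>2 - |l|\<^sup>2 - |k - l|\<^sup>2 = 2 l \<bullet> (k - l)\<close>. It shows that \<open>e\<^bsup>-is\<Delta>\<^esup>[e\<^bsup>is\<Delta>\<^esup>f \<cdot> e\<^bsup>is\<Delta>\<^esup>g]\<close> differs from \<open>f g\<close> only by the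
phases \<open>exp (2 i s l \<bullet> (k - l))\<close>, which are within \<open>O(|s|\<^sup>\<gamma> |l|\<^sup>\<gamma> |k - l|\<^sup>\<gamma>)\<close> of \<open>1\<close>; each factor loses \<open>\<gamma>\<close>
derivatives (\<open>bilinear_phase_bound\<close>). Applied repeatedly, this replaces
\<open>e\<^bsup>-is\<Delta>\<^esup>[(e\<^bsup>is\<Delta>\<^esup>u)\<^bsup>p+1\<^esup> (e\<^bsup>-is\<Delta>\<^esup>cnj u)\<^sup>p]\<close> by \<open>u\<^bsup>p+1\<^esup> \<cdot> e\<^bsup>-2is\<Delta>\<^esup>(cnj u)\<^sup>p\<close>: the factors \<open>cnj u\<close> rotate in the
opposite direction, and this single remaining oscillation is kept (\<open>twisted_product_freezing\<close>).
Its integral over \<open>s \<in> [0, \<tau>]\<close> is \<open>\<tau> \<phi>\<^sub>1(-2i\<tau>\<Delta>)\<close>, so the increment of the method is the exact integral of the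
approximate integrand, and the local error is \<open>O(\<tau>\<^bsup>1+\<gamma>\<^esup>)\<close> (\<open>local_error\<close>).

One time step expands distances in a ball of \<open>H\<^sup>r\<close> by at most \<open>1 + L \<tau>\<close>. Summing the propagated local errors
gives the global bound, and for small \<open>\<tau>\<close> this bound itself keeps the numerical solution in the
ball (\<open>scheme_convergence\<close>).

It remains to connect coefficients and functions. Uniform convergence and orthogonality identify the
coefficients of an absolutely convergent Fourier series, and products of such series correspond to
convolutions. The mild equation holds pointwise almost everywhere; Fubini's theorem
turns it into an integral equation for each coefficient (\<open>mild_solution_duhamel\<close>).
\<close>

section \<open>Weighted sequence spaces on the frequency lattice\<close>

lemma freq_add: "freq (k + l) = freq k + freq l"
  by (simp add: freq_def vec_eq_iff)

lemma freq_minus: "freq (- k) = - freq k"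
  by (simp add: freq_def vec_eq_iff)

lemma freq_diff: "freq (k - l) = freq k - freq l"
  by (simp add: freq_def vec_eq_iff)

lemma freq_zero [simp]: "freq 0 = 0"
  by (simp add: freq_def vec_eq_iff)

definition weight :: "real \<Rightarrow> int ^ 'd \<Rightarrow> real" where
  "weight r k = (1 + norm (freq k)) powr r"

lemma weight_pos [simp]: "weight r k > 0"
  unfolding weight_def powr_gt_zero using norm_ge_zero[of "freq k"] by linarith

lemma weight_nonneg [simp]: "weight r k \<ge> 0"
  using weight_pos less_imp_le by blast

lemma weight_zero [simp]: "weight r 0 = 1" "weight 0 k = 1"
  by (auto simp: weight_def) (smt (verit) norm_ge_zero)

lemma weight_minus [simp]: "weight r (- k) = weight r k"
  by (simp add: weight_def freq_minus)

lemma weight_mono: "r \<le> q \<Longrightarrow> weight r k \<le> weight q k"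
  unfolding weight_def by (rule powr_mono) auto

lemma weight_mult: "weight (r + q) k = weight r k * weight q k"
  by (simp add: weight_def powr_add)

lemma weight_add_le:
  assumes "r \<ge> 0"
  shows "weight r (l + j) \<le> 2 powr r * (weight r l + weight r j)"
proof -
  let ?L = "1 + norm (freq l)" and ?J = "1 + norm (freq j)"
  have "1 + norm (freq (l + j)) \<le> 2 * max ?L ?J"
    using norm_triangle_ineq[of "freq l" "freq j"] by (auto simp: freq_add max_def)
  then have "weight r (l + j) \<le> (2 * max ?L ?J) powr r"
    unfolding weight_def using assms by (intro powr_mono2) auto
  also have "\<dots> = 2 powr r * (max ?L ?J) powr r"
    by (rule powr_mult)
  also have "\<dots> \<le> 2 powr r * (weight r l + weight r j)"
    unfolding weight_def by (intro mult_left_mono) (auto simp: max_def)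
  finally show ?thesis .
qed

text \<open>The predicate replaces the norm: quantifying over finite partial sums makes sense for every
sequence, and no summability side conditions have to be carried through the estimates.\<close>

definition sobolev_le :: "real \<Rightarrow> (int ^ 'd \<Rightarrow> complex) \<Rightarrow> real \<Rightarrow> bool" where
  "sobolev_le r a M \<longleftrightarrow> (\<forall>F. finite F \<longrightarrow> L2_set (\<lambda>k. weight r k * cmod (a k)) F \<le> M)"

lemma sobolev_leD: "sobolev_le r a M \<Longrightarrow> finite F \<Longrightarrow> L2_set (\<lambda>k. weight r k * cmod (a k)) F \<le> M"
  by (auto simp: sobolev_le_def)

lemma sobolev_le_nonneg: "sobolev_le r a M \<Longrightarrow> 0 \<le> M"
  using sobolev_leD[of r a M "{}"] by simp

lemma sobolev_le_mono: "sobolev_le r a M \<Longrightarrow> M \<le> N \<Longrightarrow> sobolev_le r a N"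
  by (force simp: sobolev_le_def)

lemma sobolev_le_dominated:
  assumes "sobolev_le q b M" "\<And>k. weight r k * cmod (a k) \<le> weight q k * cmod (b k)"
  shows "sobolev_le r a M"
  unfolding sobolev_le_def
proof (intro allI impI)
  fix F :: "(int ^ 'a) set" assume "finite F"
  have "L2_set (\<lambda>k. weight r k * cmod (a k)) F \<le> L2_set (\<lambda>k. weight q k * cmod (b k)) F"
    by (rule L2_set_mono) (use assms(2) in auto)
  also have "\<dots> \<le> M" using assms(1) \<open>finite F\<close> by (rule sobolev_leD)
  finally show "L2_set (\<lambda>k. weight r k * cmod (a k)) F \<le> M" .
qed

lemma sobolev_le_cmod_le:
  assumes "sobolev_le r b M" "\<And>k. cmod (a k) \<le> cmod (b k)"
  shows "sobolev_le r a M"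
  using assms(1) by (rule sobolev_le_dominated) (simp add: assms(2) mult_left_mono)

lemma sobolev_le_lower_index: "sobolev_le q a M \<Longrightarrow> r \<le> q \<Longrightarrow> sobolev_le r a M"
  by (erule sobolev_le_dominated) (simp add: weight_mono mult_right_mono)

lemma sobolev_le_add:
  assumes "sobolev_le r a M" "sobolev_le r b N"
  shows "sobolev_le r (\<lambda>k. a k + b k) (M + N)"
  unfolding sobolev_le_def
proof (intro allI impI)
  fix F :: "(int ^ 'a) set" assume F: "finite F"
  have "L2_set (\<lambda>k. weight r k * cmod (a k + b k)) F
      \<le> L2_set (\<lambda>k. weight r k * cmod (a k) + weight r k * cmod (b k)) F"
    by (rule L2_set_mono) (auto simp flip: distrib_left intro: mult_left_mono norm_triangle_ineq)
  also have "\<dots> \<le> L2_set (\<lambda>k. weight r k * cmod (a k)) F + L2_set (\<lambda>k. weight r k * cmod (b k)) F"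
    by (rule L2_set_triangle_ineq)
  also have "\<dots> \<le> M + N" using assms F by (intro add_mono sobolev_leD)
  finally show "L2_set (\<lambda>k. weight r k * cmod (a k + b k)) F \<le> M + N" .
qed

lemma sobolev_le_scale:
  assumes "sobolev_le r a M"
  shows "sobolev_le r (\<lambda>k. c * a k) (cmod c * M)"
  unfolding sobolev_le_def
proof (intro allI impI)
  fix F :: "(int ^ 'a) set" assume F: "finite F"
  have "L2_set (\<lambda>k. weight r k * cmod (c * a k)) F = cmod c * L2_set (\<lambda>k. weight r k * cmod (a k)) F"
    by (simp add: L2_set_right_distrib norm_mult mult_ac)
  also have "\<dots> \<le> cmod c * M" using assms F by (intro mult_left_mono sobolev_leD) auto
  finally show "L2_set (\<lambda>k. weight r k * cmod (c * a k)) F \<le> cmod c * M" .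
qed

lemma sobolev_le_diff:
  assumes "sobolev_le r a M" "sobolev_le r b N"
  shows "sobolev_le r (\<lambda>k. a k - b k) (M + N)"
  using sobolev_le_add[OF assms(1) sobolev_le_scale[OF assms(2), of "-1"]] by simp

lemma sobolev_le_triangle:
  assumes "sobolev_le r (\<lambda>k. a k - b k) M" "sobolev_le r (\<lambda>k. b k - c k) N"
  shows "sobolev_le r (\<lambda>k. a k - c k) (M + N)"
  using sobolev_le_add[OF assms] by simp

lemma sobolev_le_coeff:
  assumes "sobolev_le r a M"
  shows "weight r k * cmod (a k) \<le> M"
  using sobolev_leD[OF assms, of "{k}"] by simp

lemma sobolev_le_sum:
  assumes "finite G" "\<And>l. l \<in> G \<Longrightarrow> sobolev_le r (g l) (m l)"
  shows "sobolev_le r (\<lambda>k. \<Sum>l\<in>G. g l k) (\<Sum>l\<in>G. m l)"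
  using assms
proof (induction G rule: finite_induct)
  case empty
  then show ?case by (simp add: sobolev_le_def L2_set_def)
next
  case (insert x G)
  then show ?case using sobolev_le_add[of r "g x" "m x"] by simp
qed

text \<open>Each finite partial sum is continuous in finitely many coefficients, so coefficientwise limits
preserve the bound.\<close>

lemma sobolev_le_limit:
  assumes "\<And>k. ((\<lambda>x. f x k) \<longlongrightarrow> a k) A" "A \<noteq> bot" "\<forall>\<^sub>F x in A. sobolev_le r (f x) M"
  shows "sobolev_le r a M"
  unfolding sobolev_le_def
proof (intro allI impI)
  fix F :: "(int ^ 'a) set" assume F: "finite F"
  have "((\<lambda>x. L2_set (\<lambda>k. weight r k * cmod (f x k)) F)
         \<longlongrightarrow> L2_set (\<lambda>k. weight r k * cmod (a k)) F) A"
    unfolding L2_set_def by (intro tendsto_intros assms)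
  then show "L2_set (\<lambda>k. weight r k * cmod (a k)) F \<le> M"
    by (rule tendsto_upperbound[OF _ _ assms(2)])
       (use assms(3) F in \<open>auto elim!: eventually_mono intro: sobolev_leD\<close>)
qed

text \<open>Minkowski's inequality for series.\<close>

lemma sobolev_le_infsum:
  fixes m :: "'l \<Rightarrow> real"
  assumes "\<And>l. sobolev_le r (g l) (m l)" "\<And>k. (\<lambda>l. g l k) summable_on UNIV"
    and "\<And>G. finite G \<Longrightarrow> (\<Sum>l\<in>G. m l) \<le> M"
  shows "sobolev_le r (\<lambda>k. \<Sum>\<^sub>\<infinity>l. g l k) M"
proof (rule sobolev_le_limit)
  show "((\<lambda>G. \<Sum>l\<in>G. g l k) \<longlongrightarrow> (\<Sum>\<^sub>\<infinity>l. g l k)) (finite_subsets_at_top UNIV)" for k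
    by (rule infsum_tendsto[OF assms(2)])
  show "\<forall>\<^sub>F G in finite_subsets_at_top UNIV. sobolev_le r (\<lambda>k. \<Sum>l\<in>G. g l k) M"
    using assms by (auto intro!: eventually_finite_subsets_at_top_weakI sobolev_le_mono[OF sobolev_le_sum])
qed simp

lemma summable_1d:
  assumes "s > 1"
  shows "(\<lambda>n::int. (1 + \<bar>real_of_int n\<bar>) powr (- s)) summable_on UNIV"
proof -
  have "summable (\<lambda>n::nat. real (Suc n) powr (- s))"
    using summable_real_powr_iff[of "-s"] assms summable_Suc_iff[of "\<lambda>n. real n powr (- s)"] by simp
  then have N: "(\<lambda>n::nat. real (Suc n) powr (- s)) summable_on UNIV"
    by (intro summable_nonneg_imp_summable_on) auto
  have "(\<lambda>n::int. (1 + \<bar>real_of_int n\<bar>) powr (- s)) summable_on (int ` UNIV)"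
    by (subst summable_on_reindex) (use N in \<open>auto simp: o_def inj_def add.commute\<close>)
  moreover have "(\<lambda>n::int. (1 + \<bar>real_of_int n\<bar>) powr (- s)) summable_on ((\<lambda>n. - int n) ` UNIV)"
    by (subst summable_on_reindex) (use N in \<open>auto simp: o_def inj_def add.commute\<close>)
  ultimately have "(\<lambda>n::int. (1 + \<bar>real_of_int n\<bar>) powr (- s)) summable_on
        (int ` UNIV \<union> (\<lambda>n. - int n) ` UNIV)"
    by (rule summable_on_union)
  moreover have "int ` UNIV \<union> (\<lambda>n. - int n) ` UNIV = UNIV"
    by (auto simp: image_iff) (metis int_cases2)
  ultimately show ?thesis by simp
qed

text \<open>Since \<open>|k\<^sub>i| \<le> |k|\<close>, the weight \<open>(1 + |k|)\<^bsup>-2r\<^esup>\<close> is at most the product over the coordinates of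
\<open>(1 + |k\<^sub>i|)\<^bsup>-s\<^esup>\<close> with \<open>s = 2r/d > 1\<close>, and the sum of a product over a box factorizes.\<close>

lemma summable_weight:
  assumes "r > real CARD('d) / 2"
  shows "\<exists>S>0. \<forall>F :: (int ^ 'd) set. finite F \<longrightarrow> (\<Sum>k\<in>F. weight (- (2 * r)) k) \<le> S"
proof -
  let ?d = "real CARD('d)"
  define s where "s = 2 * r / ?d"
  let ?f = "\<lambda>n::int. (1 + \<bar>real_of_int n\<bar>) powr (- s)"
  have s: "s > 1" using assms by (simp add: s_def field_simps)
  define S1 where "S1 = infsum ?f UNIV"
  have S1: "sum ?f G \<le> S1" if "finite G" for G
    unfolding S1_def by (rule finite_sum_le_infsum) (use that summable_1d[OF s] in auto)
  have wle: "weight (- (2 * r)) k \<le> (\<Prod>i\<in>UNIV. ?f (k $ i))" for k :: "int ^ 'd"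
  proof -
    have "weight (- (2 * r)) k = (\<Prod>i\<in>(UNIV::'d set). (1 + norm (freq k)) powr (- s))"
    proof -
      have "- (2 * r) = - s * ?d" by (simp add: s_def)
      then show ?thesis
        unfolding weight_def by (simp add: powr_powr [symmetric] powr_realpow powr_def[of _ "real _"])
          (smt (verit) norm_ge_zero powr_gt_zero powr_powr powr_realpow mult_minus_left)
    qed
    also have "\<dots> \<le> (\<Prod>i\<in>UNIV. ?f (k $ i))"
    proof (intro prod_mono conjI powr_mono2')
      fix i
      have "\<bar>real_of_int (k $ i)\<bar> \<le> norm (freq k)"
        using component_le_norm_cart[of "freq k" i] by (simp add: freq_def)
      then show "1 + \<bar>real_of_int (k $ i)\<bar> \<le> 1 + norm (freq k)" by simp
    qed (use s in auto)
    finally show ?thesis .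
  qed
  show ?thesis
  proof (intro exI[of _ "S1 ^ CARD('d) + 1"] conjI allI impI)
    have S1n: "S1 \<ge> 0" using S1[of "{}"] by simp
    then show "S1 ^ CARD('d) + 1 > 0" by (smt (verit) zero_le_power)
    fix F :: "(int ^ 'd) set" assume F: "finite F"
    define B where "B = (\<lambda>i. (\<lambda>k. k $ i) ` F)"
    have "(\<Sum>k\<in>F. weight (- (2 * r)) k) \<le> (\<Sum>k\<in>F. \<Prod>i\<in>UNIV. ?f (k $ i))"
      by (rule sum_mono) (rule wle)
    also have "\<dots> = (\<Sum>g\<in>vec_nth ` F. \<Prod>i\<in>UNIV. ?f (g i))"
      by (subst sum.reindex) (auto simp: inj_on_def vec_nth_inject)
    also have "\<dots> \<le> (\<Sum>g\<in>PiE UNIV B. \<Prod>i\<in>UNIV. ?f (g i))"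
      by (rule sum_mono2) (auto intro!: finite_PiE prod_nonneg simp: B_def F)
    also have "\<dots> = (\<Prod>i\<in>UNIV. \<Sum>n\<in>B i. ?f n)"
      by (rule prod_sum_PiE[symmetric]) (auto simp: B_def F)
    also have "\<dots> \<le> (\<Prod>i\<in>(UNIV::'d set). S1)"
      by (intro prod_mono conjI S1 sum_nonneg) (auto simp: B_def F)
    finally show "(\<Sum>k\<in>F. weight (- (2 * r)) k) \<le> S1 ^ CARD('d) + 1" by simp
  qed
qed

definition l1_le :: "('k \<Rightarrow> complex) \<Rightarrow> real \<Rightarrow> bool" where
  "l1_le a M \<longleftrightarrow> (\<forall>F. finite F \<longrightarrow> (\<Sum>k\<in>F. cmod (a k)) \<le> M)"

text \<open>The Cauchy--Schwarz inequality against \<open>summable_weight\<close>. On the side of functions this is the embedding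
of \<open>H\<^sup>r\<close> into the absolutely convergent Fourier series.\<close>

lemma sobolev_embedding_l1:
  assumes "r > real CARD('d) / 2"
  shows "\<exists>K>0. \<forall>(a :: int ^ 'd \<Rightarrow> complex) M. sobolev_le r a M \<longrightarrow> l1_le a (K * M)"
proof -
  obtain S where S: "\<And>F :: (int ^ 'd) set. finite F \<Longrightarrow> (\<Sum>k\<in>F. weight (- (2 * r)) k) \<le> S" "S > 0"
    using summable_weight[OF assms] by blast
  show ?thesis
  proof (intro exI[of _ "sqrt S"] conjI allI impI)
    fix a :: "int ^ 'd \<Rightarrow> complex" and M assume a: "sobolev_le r a M"
    show "l1_le a (sqrt S * M)"
      unfolding l1_le_def
    proof (intro allI impI)
      fix F :: "(int ^ 'd) set" assume F: "finite F"
      have "(\<Sum>k\<in>F. cmod (a k)) = (\<Sum>k\<in>F. \<bar>weight (- r) k\<bar> * \<bar>weight r k * cmod (a k)\<bar>)"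
        by (intro sum.cong refl)
           (simp add: abs_mult flip: mult.assoc weight_mult)
      also have "\<dots> \<le> L2_set (weight (- r)) F * L2_set (\<lambda>k. weight r k * cmod (a k)) F"
        by (rule L2_set_mult_ineq)
      also have "\<dots> \<le> sqrt S * M"
      proof (intro mult_mono sobolev_leD[OF a F])
        have "(weight (- r) k)\<^sup>2 = weight (- (2 * r)) k" for k :: "int ^ 'd"
          by (simp add: power2_eq_square flip: weight_mult)
        then show "L2_set (weight (- r)) F \<le> sqrt S"
          unfolding L2_set_def using S(1)[OF F] by simp
      qed (use S in auto)
      finally show "(\<Sum>k\<in>F. cmod (a k)) \<le> sqrt S * M" .
    qed
  qed (use S in auto)
qed

lemma l1_le_summable:
  assumes "l1_le a M"
  shows "(\<lambda>k. cmod (a k)) summable_on UNIV"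
  by (rule nonneg_bdd_above_summable_on) (use assms in \<open>auto simp: l1_le_def bdd_above_def\<close>)

lemma l1_le_infsum:
  assumes "l1_le a M"
  shows "(\<Sum>\<^sub>\<infinity>k. cmod (a k)) \<le> M"
  by (rule infsum_le_finite_sums[OF l1_le_summable[OF assms]]) (use assms in \<open>auto simp: l1_le_def\<close>)

lemma bij_diff: "bij (\<lambda>l. k - l :: 'a :: ab_group_add)"
  by (rule bij_betw_byWitness[where f'="\<lambda>l. k - l"]) auto

definition conv :: "('k::ab_group_add \<Rightarrow> complex) \<Rightarrow> ('k \<Rightarrow> complex) \<Rightarrow> 'k \<Rightarrow> complex" where
  "conv a b k = (\<Sum>\<^sub>\<infinity>l. a l * b (k - l))"

lemma conv_abs_summable:
  assumes "(\<lambda>k. cmod (a k)) summable_on UNIV" "\<And>k. cmod (b k) \<le> B"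
  shows "(\<lambda>l. cmod (a l * b (k - l))) summable_on UNIV"
proof (rule summable_on_comparison_test[OF summable_on_cmult_left[OF assms(1), of B]])
  show "cmod (a l * b (k - l)) \<le> cmod (a l) * B" for l
    unfolding norm_mult by (intro mult_left_mono assms) auto
qed auto

lemma sobolev_le_bounded:
  assumes "sobolev_le r a M" "r \<ge> 0"
  shows "cmod (a k) \<le> M"
  using sobolev_le_coeff[OF sobolev_le_lower_index[OF assms], of k] by simp

lemma sobolev_le_translate:
  assumes "sobolev_le 0 b B"
  shows "sobolev_le 0 (\<lambda>k. b (k - l)) B"
  unfolding sobolev_le_def
proof (intro allI impI)
  fix F :: "(int ^ 'a) set" assume F: "finite F"
  have "L2_set (\<lambda>k. weight 0 k * cmod (b (k - l))) F = L2_set (\<lambda>k. weight 0 k * cmod (b k)) ((\<lambda>k. k - l) ` F)"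
    unfolding L2_set_def by (subst sum.reindex) (auto simp: inj_on_def)
  also have "\<dots> \<le> B" by (rule sobolev_leD[OF assms]) (use F in auto)
  finally show "L2_set (\<lambda>k. weight 0 k * cmod (b (k - l))) F \<le> B" .
qed

lemma young_inequality_l1_l2:
  assumes "l1_le a A" "sobolev_le 0 b B"
  shows "sobolev_le 0 (conv a b) (A * B)"
  unfolding conv_def
proof (rule sobolev_le_infsum)
  show "sobolev_le 0 (\<lambda>k. a l * b (k - l)) (cmod (a l) * B)" for l
    by (intro sobolev_le_scale sobolev_le_translate assms)
  show "(\<lambda>l. a l * b (k - l)) summable_on UNIV" for k
    by (rule abs_summable_summable[OF conv_abs_summable[OF l1_le_summable[OF assms(1)]]])
       (rule sobolev_le_bounded[OF assms(2)], simp)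
  show "(\<Sum>l\<in>G. cmod (a l) * B) \<le> A * B" if "finite G" for G
    using that assms(1) sobolev_le_nonneg[OF assms(2)]
    by (simp add: l1_le_def mult_right_mono flip: sum_distrib_right)
qed

lemma conv_commute: "conv a b = conv b a"
proof
  fix k show "conv a b k = conv b a k"
    unfolding conv_def
    by (subst infsum_reindex_bij_betw[OF bij_diff[of k], symmetric]) (simp add: mult.commute)
qed

text \<open>\<open>H\<^sup>r\<close> is an algebra: by \<open>weight_add_le\<close> the weight at \<open>k = l + (k - l)\<close> can be moved onto one of the
two factors, and the other factor is summable. Young's inequality bounds both contributions.\<close>

lemma sobolev_conv_bound:
  assumes r: "r > real CARD('d) / 2"
  shows "\<exists>C>0. \<forall>(a :: int ^ 'd \<Rightarrow> complex) b A B.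
     sobolev_le r a A \<longrightarrow> sobolev_le r b B \<longrightarrow> sobolev_le r (conv a b) (C * A * B)"
proof -
  obtain K where K: "K > 0" "\<And>(a :: int ^ 'd \<Rightarrow> complex) M. sobolev_le r a M \<Longrightarrow> l1_le a (K * M)"
    using sobolev_embedding_l1[OF r] by blast
  have r0: "r \<ge> 0" using r by (smt (verit) divide_nonneg_nonneg of_nat_0_le_iff)
  show ?thesis
  proof (intro exI[of _ "2 powr r * 2 * K"] conjI allI impI)
    fix a b :: "int ^ 'd \<Rightarrow> complex" and A B
    assume a: "sobolev_le r a A" and b: "sobolev_le r b B"
    \<comment> \<open>w carries the weight, n only the modulus; complex values allow conv to be reused.\<close>
    define w where "w = (\<lambda>(x :: int ^ 'd \<Rightarrow> complex) k. complex_of_real (weight r k * cmod (x k)))"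
    define n where "n = (\<lambda>(x :: int ^ 'd \<Rightarrow> complex) k. complex_of_real (cmod (x k)))"
    have l1: "l1_le (n x) (K * X)" if "sobolev_le r x X" for x X
      using K(2)[OF that] by (simp add: l1_le_def n_def)
    have l2: "sobolev_le 0 (w x) X" if "sobolev_le r x X" for x X
      using that by (rule sobolev_le_dominated) (simp add: w_def norm_mult)
    have s1: "(\<lambda>l. cmod (n a l * w b (k - l))) summable_on UNIV" for k
      by (rule conv_abs_summable[OF l1_le_summable[OF l1[OF a]]], rule sobolev_le_bounded[OF l2[OF b]]) simp
    have s2': "(\<lambda>l. cmod (n b l * w a (k - l))) summable_on UNIV" for k
      by (rule conv_abs_summable[OF l1_le_summable[OF l1[OF b]]], rule sobolev_le_bounded[OF l2[OF a]]) simp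
    have s2: "(\<lambda>l. cmod (w a l * n b (k - l))) summable_on UNIV" for k
      by (subst summable_on_reindex_bij_betw[OF bij_diff[of k], symmetric]) (use s2'[of k] in \<open>simp add: mult.commute\<close>)
    have "sobolev_le 0 (\<lambda>k. conv (n a) (w b) k + conv (n b) (w a) k) (K * A * B + K * B * A)"
      by (intro sobolev_le_add young_inequality_l1_l2 l1 l2 a b)
    then have "sobolev_le 0 (\<lambda>k. (2 powr r) * (conv (n a) (w b) k + conv (n b) (w a) k))
        (cmod (2 powr r) * (K * A * B + K * B * A))"
      by (rule sobolev_le_scale)
    then have X: "sobolev_le 0 (\<lambda>k. (2 powr r) * (conv (n a) (w b) k + conv (n b) (w a) k))
        (2 powr r * 2 * K * A * B)"
      by (rule sobolev_le_mono) (simp add: norm_powr_real_powr field_simps)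
    show "sobolev_le r (conv a b) (2 powr r * 2 * K * A * B)"
    proof (rule sobolev_le_dominated[OF X])
      fix k
      have bb: "cmod (b l) \<le> B" for l by (rule sobolev_le_bounded[OF b r0])
      have sab: "(\<lambda>l. cmod (a l * b (k - l))) summable_on UNIV"
        by (rule conv_abs_summable[OF l1_le_summable[OF K(2)[OF a]] bb])
      have "weight r k * cmod (conv a b k) \<le> weight r k * (\<Sum>\<^sub>\<infinity>l. cmod (a l * b (k - l)))"
        unfolding conv_def by (intro mult_left_mono norm_infsum_bound) (use sab in auto)
      also have "\<dots> = (\<Sum>\<^sub>\<infinity>l. weight r k * cmod (a l * b (k - l)))"
        by (rule infsum_cmult_right'[symmetric])
      also have "\<dots> \<le> (\<Sum>\<^sub>\<infinity>l. 2 powr r * (cmod (w a l * n b (k - l)) + cmod (n a l * w b (k - l))))"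
      proof (rule infsum_mono)
        fix l
        have "weight r k \<le> 2 powr r * (weight r l + weight r (k - l))"
          using weight_add_le[OF r0, of l "k - l"] by simp
        then have "weight r k * (cmod (a l) * cmod (b (k - l)))
           \<le> 2 powr r * (weight r l + weight r (k - l)) * (cmod (a l) * cmod (b (k - l)))"
          by (rule mult_right_mono) auto
        then show "weight r k * cmod (a l * b (k - l))
            \<le> 2 powr r * (cmod (w a l * n b (k - l)) + cmod (n a l * w b (k - l)))"
          by (simp add: w_def n_def norm_mult algebra_simps)
      qed (intro summable_on_cmult_right summable_on_add s1 s2 sab)+
      also have "\<dots> = 2 powr r * ((\<Sum>\<^sub>\<infinity>l. cmod (w a l * n b (k - l))) + (\<Sum>\<^sub>\<infinity>l. cmod (n a l * w b (k - l))))"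
        by (simp add: infsum_cmult_right' infsum_add[OF s2 s1])
      also have "\<dots> = cmod (2 powr r * (conv (n a) (w b) k + conv (n b) (w a) k))"
      proof -
        have c: "conv (n x) (w y) k = complex_of_real (\<Sum>\<^sub>\<infinity>l. cmod (n x l * w y (k - l)))"
          if "(\<lambda>l. cmod (n x l * w y (k - l))) summable_on UNIV" for x y
          unfolding conv_def
        proof (rule infsumI)
          show "((\<lambda>l. n x l * w y (k - l)) has_sum of_real (\<Sum>\<^sub>\<infinity>l. cmod (n x l * w y (k - l)))) UNIV"
            using has_sum_of_real[OF has_sum_infsum[OF that], where 'a=complex]
            by (simp add: n_def w_def norm_mult)
        qed
        have e: "(\<Sum>\<^sub>\<infinity>l. cmod (w a l * n b (k - l))) = (\<Sum>\<^sub>\<infinity>l. cmod (n b l * w a (k - l)))"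
          by (subst infsum_reindex_bij_betw[OF bij_diff[of k], symmetric]) (simp add: mult.commute)
        show ?thesis
          unfolding c[OF s1] c[OF s2'] e
          by (simp add: norm_mult norm_powr_real_powr infsum_nonneg flip: of_real_add)
      qed
      finally show "weight r k * cmod (conv a b k) \<le> weight 0 k * cmod (2 powr r * (conv (n a) (w b) k + conv (n b) (w a) k))"
        by simp
    qed
  qed (use K in auto)
qed

section \<open>Powers, conjugation and the free Schroedinger flow\<close>

lemma cis_minus_one_le: "cmod (cis \<theta> - 1) \<le> \<bar>\<theta>\<bar>"
proof -
  have "(cmod (cis \<theta> - 1))\<^sup>2 = 2 - 2 * cos (2 * (\<theta> / 2))"
    unfolding cmod_power2 using sin_cos_squared_add[of \<theta>] by (simp add: power2_eq_square algebra_simps)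
  also have "\<dots> = (2 * sin (\<theta> / 2))\<^sup>2"
    unfolding cos_double_sin by (simp add: power2_eq_square)
  also have "\<dots> \<le> \<theta>\<^sup>2"
    using abs_sin_x_le_abs_x[of "\<theta> / 2"] by (subst abs_le_square_iff[symmetric]) (simp add: abs_mult)
  finally show ?thesis
    by (simp add: abs_le_square_iff[symmetric])
qed

text \<open>Interpolation between the bounds \<open>|\<theta>|\<close> and \<open>2\<close>: this is where only \<open>\<gamma>\<close> derivatives are paid for a
factor \<open>s\<^sup>\<gamma>\<close> in the local error.\<close>

lemma cis_minus_one_le_powr:
  assumes "0 < \<gamma>" "\<gamma> \<le> 1"
  shows "cmod (cis \<theta> - 1) \<le> 2 * \<bar>\<theta>\<bar> powr \<gamma>"
proof (cases "\<bar>\<theta>\<bar> \<le> 1")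
  case True
  have "\<bar>\<theta>\<bar> \<le> \<bar>\<theta>\<bar> powr \<gamma>"
  proof (cases "\<theta> = 0")
    case False
    then show ?thesis using powr_mono'[of \<gamma> 1 "\<bar>\<theta>\<bar>"] True assms by simp
  qed simp
  then show ?thesis using cis_minus_one_le[of \<theta>] by linarith
next
  case False
  have "cmod (cis \<theta> - 1) \<le> 2" using norm_triangle_ineq4[of "cis \<theta>" 1] by simp
  moreover have "1 \<le> \<bar>\<theta>\<bar> powr \<gamma>" using False assms ge_one_powr_ge_zero by simp
  ultimately show ?thesis by linarith
qed

lemma norm_phi1_le: "cmod (phi1 (\<i> * of_real \<theta>)) \<le> 1"
  using cis_minus_one_le[of \<theta>] by (auto simp: phi1_def norm_divide norm_mult field_simps cis_conv_exp)

definition unit_seq :: "'k::ab_group_add \<Rightarrow> complex" where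
  "unit_seq k = (if k = 0 then 1 else 0)"

primrec conv_pow :: "('k::ab_group_add \<Rightarrow> complex) \<Rightarrow> nat \<Rightarrow> 'k \<Rightarrow> complex" where
  "conv_pow a 0 = unit_seq"
| "conv_pow a (Suc n) = conv a (conv_pow a n)"

definition flow :: "real \<Rightarrow> (int ^ 'd \<Rightarrow> complex) \<Rightarrow> int ^ 'd \<Rightarrow> complex" where
  "flow s a k = cis (- s * (norm (freq k))\<^sup>2) * a k"

definition conj_seq :: "('k::ab_group_add \<Rightarrow> complex) \<Rightarrow> 'k \<Rightarrow> complex" where
  "conj_seq a k = cnj (a (- k))"

lemma flow_add: "flow s (flow t a) = flow (s + t) a"
  by (auto simp: flow_def cis_mult algebra_simps simp flip: mult.assoc)

lemma flow_0 [simp]: "flow 0 a = a"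
  by (auto simp: flow_def)

lemma flow_inverse [simp]: "flow s (flow (- s) a) = a" "flow (- s) (flow s a) = a"
  by (auto simp: flow_add)

lemma flow_diff: "(\<lambda>k. flow s a k - flow s b k) = flow s (\<lambda>k. a k - b k)"
  by (auto simp: flow_def algebra_simps)

lemma conj_seq_flow: "conj_seq (flow s a) = flow (- s) (conj_seq a)"
  by (auto simp: flow_def conj_seq_def freq_minus cis_cnj)

lemma conj_seq_diff: "(\<lambda>k. conj_seq a k - conj_seq b k) = conj_seq (\<lambda>k. a k - b k)"
  by (auto simp: conj_seq_def)

lemma sobolev_le_flow [simp]: "sobolev_le r (flow s a) M \<longleftrightarrow> sobolev_le r a M"
  by (simp add: sobolev_le_def flow_def norm_mult)

lemma sobolev_le_conj_seq:
  assumes "sobolev_le r a M"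
  shows "sobolev_le r (conj_seq a) M"
  unfolding sobolev_le_def
proof (intro allI impI)
  fix F :: "(int ^ 'a) set" assume F: "finite F"
  have "L2_set (\<lambda>k. weight r k * cmod (conj_seq a k)) F
      = L2_set (\<lambda>k. weight r k * cmod (a k)) (uminus ` F)"
    unfolding L2_set_def by (subst sum.reindex) (auto simp: conj_seq_def)
  also have "\<dots> \<le> M" by (rule sobolev_leD[OF assms]) (use F in auto)
  finally show "L2_set (\<lambda>k. weight r k * cmod (conj_seq a k)) F \<le> M" .
qed

lemma sobolev_le_multiplier:
  assumes "sobolev_le r a M" "\<And>k. cmod (m k) \<le> 1"
  shows "sobolev_le r (\<lambda>k. m k * a k) M"
  using assms(1) by (rule sobolev_le_cmod_le) (simp add: norm_mult assms(2) mult_left_le_one_le)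

lemma sobolev_le_unit_seq: "sobolev_le r unit_seq 1"
  unfolding sobolev_le_def
proof (intro allI impI)
  fix F :: "(int ^ 'a) set" assume F: "finite F"
  have "L2_set (\<lambda>k. weight r k * cmod (unit_seq k)) F \<le> (\<Sum>k\<in>F. weight r k * cmod (unit_seq k))"
    by (rule L2_set_le_sum) simp
  also have "\<dots> = (\<Sum>k\<in>F. if k = 0 then 1 else 0)"
    by (intro sum.cong) (auto simp: unit_seq_def)
  also have "\<dots> \<le> 1" using F by simp
  finally show "L2_set (\<lambda>k. weight r k * cmod (unit_seq k)) F \<le> 1" .
qed

lemma conv_diff_right:
  assumes "l1_le a A" "\<And>k. cmod (b k) \<le> B" "\<And>k. cmod (c k) \<le> C"
  shows "conv a (\<lambda>k. b k - c k) = (\<lambda>k. conv a b k - conv a c k)"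
proof
  fix k
  have "(\<lambda>l. a l * b (k - l)) summable_on UNIV" "(\<lambda>l. a l * c (k - l)) summable_on UNIV"
    by (rule abs_summable_summable[OF conv_abs_summable[OF l1_le_summable[OF assms(1)]]], rule assms)+
  then have "(\<Sum>\<^sub>\<infinity>l. a l * b (k - l) + - (a l * c (k - l))) = conv a b k + (\<Sum>\<^sub>\<infinity>l. - (a l * c (k - l)))"
    unfolding conv_def by (intro infsum_add) (auto simp: summable_on_uminus)
  then show "conv a (\<lambda>k. b k - c k) k = conv a b k - conv a c k"
    by (simp add: conv_def right_diff_distrib infsum_uminus)
qed

text \<open>The dimension is passed as a type argument so that the constants of \<open>H\<^sup>r\<close> and \<open>H\<^bsup>r+\<gamma>\<^esup>\<close> can be fixed
for the same torus in the locales below.\<close>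

definition sobolev_algebra_consts :: "real \<Rightarrow> real \<Rightarrow> real \<Rightarrow> 'd::finite itself \<Rightarrow> bool" where
  "sobolev_algebra_consts r C K torus \<longleftrightarrow> r \<ge> 0 \<and>
     (\<forall>(a :: int ^ 'd \<Rightarrow> complex) b A B.
        sobolev_le r a A \<longrightarrow> sobolev_le r b B \<longrightarrow> sobolev_le r (conv a b) (C * A * B)) \<and>
     (\<forall>(a :: int ^ 'd \<Rightarrow> complex) A. sobolev_le r a A \<longrightarrow> l1_le a (K * A))"

lemma sobolev_algebra_consts_exist:
  assumes "r > real CARD('d::finite) / 2"
  obtains C K where "sobolev_algebra_consts r C K TYPE('d)"
proof -
  obtain C where C: "C > 0" "\<And>(a :: int ^ 'd \<Rightarrow> complex) b A B.
     sobolev_le r a A \<Longrightarrow> sobolev_le r b B \<Longrightarrow> sobolev_le r (conv a b) (C * A * B)"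
    using sobolev_conv_bound[OF assms] by blast
  obtain K where K: "\<And>(a :: int ^ 'd \<Rightarrow> complex) M. sobolev_le r a M \<Longrightarrow> l1_le a (K * M)"
    using sobolev_embedding_l1[OF assms] by blast
  have "r \<ge> 0" using assms by (smt (verit) divide_nonneg_nonneg of_nat_0_le_iff)
  then show thesis
    by (intro that[of C K]) (use C K in \<open>auto simp: sobolev_algebra_consts_def\<close>)
qed

locale sobolev_algebra =
  fixes r C K :: real and torus :: "'d::finite itself"
  assumes algebra: "sobolev_algebra_consts r C K torus"
begin

lemma r_nonneg: "r \<ge> 0"
  and conv_bound: "\<And>(a :: int ^ 'd \<Rightarrow> complex) b A B.
      sobolev_le r a A \<Longrightarrow> sobolev_le r b B \<Longrightarrow> sobolev_le r (conv a b) (C * A * B)"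
  and l1_bound: "\<And>(a :: int ^ 'd \<Rightarrow> complex) A. sobolev_le r a A \<Longrightarrow> l1_le a (K * A)"
  using algebra by (auto simp: sobolev_algebra_consts_def)

end

context sobolev_algebra
begin

lemma conv_diff_right_bound:
  fixes a b c :: "int ^ 'd \<Rightarrow> complex"
  assumes "sobolev_le r a A" "sobolev_le r b B" "sobolev_le r c B'" "sobolev_le r (\<lambda>k. b k - c k) D"
  shows "sobolev_le r (\<lambda>k. conv a b k - conv a c k) (C * A * D)"
  using conv_bound[OF assms(1,4)]
  by (subst (asm) conv_diff_right[OF l1_bound[OF assms(1)] sobolev_le_bounded[OF assms(2) r_nonneg]
        sobolev_le_bounded[OF assms(3) r_nonneg]])

lemma conv_diff_left_bound:
  fixes a b c :: "int ^ 'd \<Rightarrow> complex"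
  assumes "sobolev_le r a A" "sobolev_le r b B" "sobolev_le r c B'" "sobolev_le r (\<lambda>k. b k - c k) D"
  shows "sobolev_le r (\<lambda>k. conv b a k - conv c a k) (C * A * D)"
  using conv_diff_right_bound[OF assms] by (simp add: conv_commute)

lemma conv_pow_bound:
  "\<exists>B. \<forall>a :: int ^ 'd \<Rightarrow> complex. sobolev_le r a A \<longrightarrow> sobolev_le r (conv_pow a n) B"
proof (induction n)
  case 0
  show ?case using sobolev_le_unit_seq by auto
next
  case (Suc n)
  then obtain B where "\<And>a :: int ^ 'd \<Rightarrow> complex. sobolev_le r a A \<Longrightarrow> sobolev_le r (conv_pow a n) B" by blast
  then show ?case by (auto intro!: exI[of _ "C * A * B"] conv_bound)
qed

lemma conv_pow_lipschitz:
  "\<exists>L. \<forall>(a :: int ^ 'd \<Rightarrow> complex) b D. sobolev_le r a A \<and> sobolev_le r b A \<and> sobolev_le r (\<lambda>k. a k - b k) D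
      \<longrightarrow> sobolev_le r (\<lambda>k. conv_pow a n k - conv_pow b n k) (L * D)"
proof (induction n)
  case 0
  show ?case by (auto intro!: exI[of _ 0] simp: sobolev_le_def L2_set_def)
next
  case (Suc n)
  then obtain L where L: "\<And>(a :: int ^ 'd \<Rightarrow> complex) b D. sobolev_le r a A \<Longrightarrow> sobolev_le r b A \<Longrightarrow>
      sobolev_le r (\<lambda>k. a k - b k) D \<Longrightarrow> sobolev_le r (\<lambda>k. conv_pow a n k - conv_pow b n k) (L * D)" by blast
  obtain B where B: "\<And>a :: int ^ 'd \<Rightarrow> complex. sobolev_le r a A \<Longrightarrow> sobolev_le r (conv_pow a n) B"
    using conv_pow_bound[of A n] by blast
  show ?case
  proof (intro exI[of _ "C * A * L + C * B"] allI impI, elim conjE)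
    fix a b :: "int ^ 'd \<Rightarrow> complex" and D
    assume *: "sobolev_le r a A" "sobolev_le r b A" "sobolev_le r (\<lambda>k. a k - b k) D"
    have "sobolev_le r (\<lambda>k. conv a (conv_pow a n) k - conv b (conv_pow b n) k)
        (C * A * (L * D) + C * B * D)"
      by (rule sobolev_le_triangle[OF conv_diff_right_bound conv_diff_left_bound])
         (rule * B L)+
    then show "sobolev_le r (\<lambda>k. conv_pow a (Suc n) k - conv_pow b (Suc n) k) ((C * A * L + C * B) * D)"
      by (simp add: algebra_simps)
  qed
qed

end

section \<open>The twisted nonlinearity with a multiplier on the conjugated factor\<close>

text \<open>A common form of the three integrands. With \<open>u\<close> the function whose coefficients are \<open>flow t a\<close>, these
are the coefficients of \<open>e\<^bsup>-it\<Delta>\<^esup>[u\<^bsup>p+1\<^esup> m(\<nabla>) (cnj u)\<^sup>p]\<close>. The multiplier \<open>m = 1\<close> gives the nonlinearity of the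
equation, the phase \<open>m k = exp (2 i s |k|\<^sup>2)\<close> the integrand that the method keeps, and
\<open>m k = \<phi>\<^sub>1 (2 i \<tau> |k|\<^sup>2)\<close> the increment of the method, each up to a
scalar factor. All three have \<open>|m| \<le> 1\<close>.\<close>

definition twisted_product ::
  "nat \<Rightarrow> real \<Rightarrow> (int ^ 'd \<Rightarrow> complex) \<Rightarrow> (int ^ 'd \<Rightarrow> complex) \<Rightarrow> int ^ 'd \<Rightarrow> complex" where
  "twisted_product p t m a =
     flow (- t) (conv (conv_pow (flow t a) (p + 1))
                      (\<lambda>k. m k * conv_pow (flow (- t) (conj_seq a)) p k))"

context sobolev_algebra
begin

lemma twisted_product_bound:
  "\<exists>B. \<forall>(a :: int ^ 'd \<Rightarrow> complex) t m. sobolev_le r a A \<and> (\<forall>k. cmod (m k) \<le> 1)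
     \<longrightarrow> sobolev_le r (twisted_product p t m a) B"
proof -
  obtain B1 B2 where B: "\<And>a :: int ^ 'd \<Rightarrow> complex. sobolev_le r a A \<Longrightarrow> sobolev_le r (conv_pow a (p + 1)) B1"
    "\<And>a :: int ^ 'd \<Rightarrow> complex. sobolev_le r a A \<Longrightarrow> sobolev_le r (conv_pow a p) B2"
    using conv_pow_bound[of A "p + 1"] conv_pow_bound[of A p] by blast
  have "sobolev_le r (twisted_product p t m a) (C * B1 * B2)"
    if "sobolev_le r a A" "\<forall>k. cmod (m k) \<le> 1" for a :: "int ^ 'd \<Rightarrow> complex" and t m
    unfolding twisted_product_def sobolev_le_flow
    by (intro conv_bound sobolev_le_multiplier B) (use that in \<open>auto intro: sobolev_le_conj_seq\<close>)
  then show ?thesis by blast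
qed

lemma twisted_product_lipschitz:
  "\<exists>L\<ge>0. \<forall>(a :: int ^ 'd \<Rightarrow> complex) b D t m.
     sobolev_le r a A \<and> sobolev_le r b A \<and> sobolev_le r (\<lambda>k. a k - b k) D \<and> (\<forall>k. cmod (m k) \<le> 1)
     \<longrightarrow> sobolev_le r (\<lambda>k. twisted_product p t m a k - twisted_product p t m b k) (L * D)"
proof -
  obtain B1 B2 where B: "\<And>a :: int ^ 'd \<Rightarrow> complex. sobolev_le r a A \<Longrightarrow> sobolev_le r (conv_pow a (p + 1)) B1"
    "\<And>a :: int ^ 'd \<Rightarrow> complex. sobolev_le r a A \<Longrightarrow> sobolev_le r (conv_pow a p) B2"
    using conv_pow_bound[of A "p + 1"] conv_pow_bound[of A p] by blast
  obtain L1 L2 where L: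
    "\<And>(a :: int ^ 'd \<Rightarrow> complex) b D. sobolev_le r a A \<Longrightarrow> sobolev_le r b A \<Longrightarrow> sobolev_le r (\<lambda>k. a k - b k) D
      \<Longrightarrow> sobolev_le r (\<lambda>k. conv_pow a (p + 1) k - conv_pow b (p + 1) k) (L1 * D)"
    "\<And>(a :: int ^ 'd \<Rightarrow> complex) b D. sobolev_le r a A \<Longrightarrow> sobolev_le r b A \<Longrightarrow> sobolev_le r (\<lambda>k. a k - b k) D
      \<Longrightarrow> sobolev_le r (\<lambda>k. conv_pow a p k - conv_pow b p k) (L2 * D)"
    using conv_pow_lipschitz[of A "p + 1"] conv_pow_lipschitz[of A p] by blast
  let ?L = "C * B1 * L2 + C * B2 * L1"
  have "sobolev_le r (\<lambda>k. twisted_product p t m a k - twisted_product p t m b k) (\<bar>?L\<bar> * D)"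
    if a: "sobolev_le r a A" and b: "sobolev_le r b A" and D: "sobolev_le r (\<lambda>k. a k - b k) D"
      and m: "\<forall>k. cmod (m k) \<le> 1" for a b :: "int ^ 'd \<Rightarrow> complex" and t m D
  proof -
    let ?P = "\<lambda>a. conv_pow (flow t a) (p + 1)" and ?R = "\<lambda>a. conv_pow (flow (- t) (conj_seq a)) p"
    let ?Q = "\<lambda>a k. m k * ?R a k"
    have P: "sobolev_le r (?P x) B1" if "sobolev_le r x A" for x :: "int ^ 'd \<Rightarrow> complex"
      by (rule B) (use that in simp)
    have R: "sobolev_le r (?R x) B2" if "sobolev_le r x A" for x :: "int ^ 'd \<Rightarrow> complex"
      by (rule B) (use that in \<open>simp add: sobolev_le_conj_seq\<close>)
    have Q: "sobolev_le r (?Q x) B2" if "sobolev_le r x A" for x :: "int ^ 'd \<Rightarrow> complex"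
      by (rule sobolev_le_multiplier[OF R[OF that]]) (use m in auto)
    have dP: "sobolev_le r (\<lambda>k. ?P a k - ?P b k) (L1 * D)"
      by (rule L) (use a b D in \<open>auto simp: flow_diff\<close>)
    have dR: "sobolev_le r (\<lambda>k. ?R a k - ?R b k) (L2 * D)"
      by (rule L) (use a b D in \<open>auto simp: flow_diff conj_seq_diff sobolev_le_conj_seq\<close>)
    have dQ: "sobolev_le r (\<lambda>k. ?Q a k - ?Q b k) (L2 * D)"
      using sobolev_le_multiplier[OF dR, of m] m by (simp add: right_diff_distrib)
    have "sobolev_le r (\<lambda>k. conv (?P a) (?Q a) k - conv (?P b) (?Q b) k) (C * B1 * (L2 * D) + C * B2 * (L1 * D))"
      by (rule sobolev_le_triangle[OF conv_diff_right_bound[OF P Q Q] conv_diff_left_bound[OF Q P P]])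
         (rule a b dP dQ)+
    then have "sobolev_le r (\<lambda>k. conv (?P a) (?Q a) k - conv (?P b) (?Q b) k) (\<bar>?L\<bar> * D)"
      by (rule sobolev_le_mono) (use mult_right_mono[OF abs_ge_self[of ?L] sobolev_le_nonneg[OF D]] in \<open>simp add: algebra_simps\<close>)
    then show ?thesis
      unfolding twisted_product_def flow_diff sobolev_le_flow .
  qed
  then show ?thesis by (intro exI[of _ "\<bar>?L\<bar>"] conjI allI impI) auto
qed

end

section \<open>Freezing the oscillations\<close>

lemma norm_freq_polarization:
  "(norm (freq (k :: int ^ 'd)))\<^sup>2 - (norm (freq l))\<^sup>2 - (norm (freq (k - l)))\<^sup>2 = 2 * (freq l \<bullet> freq (k - l))"
  by (simp add: freq_diff power2_norm_eq_inner inner_diff inner_commute)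

text \<open>The key estimate. By \<open>norm_freq_polarization\<close> conjugating a product by the flow multiplies the
interaction of the frequencies \<open>l\<close> and \<open>k - l\<close> by \<open>exp (2 i s l \<bullet> (k - l))\<close>. Unlike \<open>|k|\<^sup>2\<close> this phase is
bilinear, so \<open>\<bar>s l \<bullet> (k - l)\<bar>\<^sup>\<gamma>\<close> distributes \<open>\<gamma>\<close> derivatives on each factor, whereas the crude bound
would put \<open>2\<gamma>\<close> derivatives on a single one.\<close>

lemma (in sobolev_algebra) bilinear_phase_bound:
  fixes a b :: "int ^ 'd \<Rightarrow> complex"
  assumes \<gamma>: "0 < \<gamma>" "\<gamma> \<le> 1"
    and a: "sobolev_le (r + \<gamma>) a A" and b: "sobolev_le (r + \<gamma>) b B"
  shows "sobolev_le r (\<lambda>k. flow (- s) (conv (flow s a) (flow s b)) k - conv a b k)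
           (4 * C * \<bar>s\<bar> powr \<gamma> * A * B)"
proof -
  define w where "w = (\<lambda>(x :: int ^ 'd \<Rightarrow> complex) k. complex_of_real (weight \<gamma> k * cmod (x k)))"
  have w: "sobolev_le r (w x) X" if "sobolev_le (r + \<gamma>) x X" for x X
    using that by (rule sobolev_le_dominated) (simp add: w_def norm_mult weight_mult)
  have rg: "sobolev_le r x X" if "sobolev_le (r + \<gamma>) x X" for x :: "int ^ 'd \<Rightarrow> complex" and X
    by (rule sobolev_le_lower_index[OF that]) (use \<gamma> in simp)
  have "sobolev_le r (\<lambda>k. of_real (4 * \<bar>s\<bar> powr \<gamma>) * conv (w a) (w b) k) (cmod (of_real (4 * \<bar>s\<bar> powr \<gamma>)) * (C * A * B))"
    by (intro sobolev_le_scale conv_bound w a b)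
  then have X: "sobolev_le r (\<lambda>k. of_real (4 * \<bar>s\<bar> powr \<gamma>) * conv (w a) (w b) k) (4 * C * \<bar>s\<bar> powr \<gamma> * A * B)"
    by (rule sobolev_le_mono) (simp add: norm_mult mult_ac)
  show ?thesis
  proof (rule sobolev_le_cmod_le[OF X])
    fix k :: "int ^ 'd"
    define \<theta> where "\<theta> = (\<lambda>l. 2 * s * (freq l \<bullet> freq (k - l)))"
    have sab: "(\<lambda>l. cmod (x l * y (k - l))) summable_on UNIV"
      if "sobolev_le r x X" "sobolev_le r y Y" for x y :: "int ^ 'd \<Rightarrow> complex" and X Y
      by (rule conv_abs_summable[OF l1_le_summable[OF l1_bound[OF that(1)]] sobolev_le_bounded[OF that(2) r_nonneg]])
    note s1 = sab[OF rg[OF a] rg[OF b]] and s2 = sab[OF w[OF a] w[OF b]]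
    have s3: "(\<lambda>l. cmod (cis (\<theta> l) * (a l * b (k - l)))) summable_on UNIV"
      using s1 by (simp add: norm_mult)
    have s1': "(\<lambda>l. cmod (- (a l * b (k - l)))) summable_on UNIV"
      using s1 by simp
    have "flow (- s) (conv (flow s a) (flow s b)) k
       = (\<Sum>\<^sub>\<infinity>l. cis (s * (norm (freq k))\<^sup>2) * (flow s a l * flow s b (k - l)))"
      by (simp add: flow_def[of "- s"] conv_def infsum_cmult_right')
    also have "\<dots> = (\<Sum>\<^sub>\<infinity>l. cis (\<theta> l) * (a l * b (k - l)))"
    proof (rule infsum_cong)
      fix l
      have "cis (s * (norm (freq k))\<^sup>2) * (flow s a l * flow s b (k - l))
          = (cis (s * (norm (freq k))\<^sup>2) * cis (- s * (norm (freq l))\<^sup>2) * cis (- s * (norm (freq (k - l)))\<^sup>2))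
            * (a l * b (k - l))"
        by (simp add: flow_def)
      also have "cis (s * (norm (freq k))\<^sup>2) * cis (- s * (norm (freq l))\<^sup>2) * cis (- s * (norm (freq (k - l)))\<^sup>2)
          = cis (\<theta> l)"
      proof -
        have "s * (norm (freq k))\<^sup>2 + - s * (norm (freq l))\<^sup>2 + - s * (norm (freq (k - l)))\<^sup>2
           = s * ((norm (freq k))\<^sup>2 - (norm (freq l))\<^sup>2 - (norm (freq (k - l)))\<^sup>2)"
          by (simp add: algebra_simps)
        also have "\<dots> = \<theta> l" by (simp add: norm_freq_polarization \<theta>_def)
        finally show ?thesis by (simp add: cis_mult)
      qed
      finally show "cis (s * (norm (freq k))\<^sup>2) * (flow s a l * flow s b (k - l))
          = cis (\<theta> l) * (a l * b (k - l))" .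
    qed
    finally have "flow (- s) (conv (flow s a) (flow s b)) k - conv a b k
       = (\<Sum>\<^sub>\<infinity>l. cis (\<theta> l) * (a l * b (k - l))) + (\<Sum>\<^sub>\<infinity>l. - (a l * b (k - l)))"
      by (simp add: conv_def infsum_uminus)
    also have "\<dots> = (\<Sum>\<^sub>\<infinity>l. cis (\<theta> l) * (a l * b (k - l)) + - (a l * b (k - l)))"
      by (rule infsum_add[symmetric, OF abs_summable_summable[OF s3] abs_summable_summable[OF s1']])
    also have "\<dots> = (\<Sum>\<^sub>\<infinity>l. (cis (\<theta> l) - 1) * (a l * b (k - l)))"
      by (simp add: algebra_simps)
    also have "cmod \<dots> \<le> (\<Sum>\<^sub>\<infinity>l. 4 * \<bar>s\<bar> powr \<gamma> * cmod (w a l * w b (k - l)))"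
    proof (rule norm_infsum_le)
      show "((\<lambda>l. (cis (\<theta> l) - 1) * (a l * b (k - l))) has_sum
          (\<Sum>\<^sub>\<infinity>l. (cis (\<theta> l) - 1) * (a l * b (k - l)))) UNIV"
      proof (rule has_sum_infsum)
        have "(\<lambda>l. cis (\<theta> l) * (a l * b (k - l)) + - (a l * b (k - l))) summable_on UNIV"
          by (rule summable_on_add[OF abs_summable_summable[OF s3] abs_summable_summable[OF s1']])
        then show "(\<lambda>l. (cis (\<theta> l) - 1) * (a l * b (k - l))) summable_on UNIV"
          by (simp add: left_diff_distrib)
      qed
      show "((\<lambda>l. 4 * \<bar>s\<bar> powr \<gamma> * cmod (w a l * w b (k - l))) has_sum
           (\<Sum>\<^sub>\<infinity>l. 4 * \<bar>s\<bar> powr \<gamma> * cmod (w a l * w b (k - l)))) UNIV"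
        by (intro has_sum_infsum summable_on_cmult_right s2)
      fix l
      have "\<bar>\<theta> l\<bar> \<le> 2 * \<bar>s\<bar> * ((1 + norm (freq l)) * (1 + norm (freq (k - l))))"
      proof -
        have "\<bar>freq l \<bullet> freq (k - l)\<bar> \<le> norm (freq l) * norm (freq (k - l))"
          by (rule Cauchy_Schwarz_ineq2)
        also have "\<dots> \<le> (1 + norm (freq l)) * (1 + norm (freq (k - l)))"
          by (intro mult_mono) auto
        finally show ?thesis unfolding \<theta>_def abs_mult by (simp add: mult_left_mono mult.assoc)
      qed
      then have "\<bar>\<theta> l\<bar> powr \<gamma> \<le> (2 * \<bar>s\<bar> * ((1 + norm (freq l)) * (1 + norm (freq (k - l))))) powr \<gamma>"
        using \<gamma> by (intro powr_mono2) auto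
      also have "\<dots> = 2 powr \<gamma> * (\<bar>s\<bar> powr \<gamma> * (weight \<gamma> l * weight \<gamma> (k - l)))"
        by (simp add: powr_mult weight_def)
      also have "\<dots> \<le> 2 * (\<bar>s\<bar> powr \<gamma> * (weight \<gamma> l * weight \<gamma> (k - l)))"
        using \<gamma> powr_mono[of \<gamma> 1 2] by (intro mult_right_mono) auto
      finally have "cmod (cis (\<theta> l) - 1) \<le> 4 * \<bar>s\<bar> powr \<gamma> * (weight \<gamma> l * weight \<gamma> (k - l))"
        using cis_minus_one_le_powr[OF \<gamma>, of "\<theta> l"] by linarith
      then have "cmod (cis (\<theta> l) - 1) * (cmod (a l) * cmod (b (k - l)))
         \<le> 4 * \<bar>s\<bar> powr \<gamma> * (weight \<gamma> l * weight \<gamma> (k - l)) * (cmod (a l) * cmod (b (k - l)))"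
        by (rule mult_right_mono) simp
      then show "cmod ((cis (\<theta> l) - 1) * (a l * b (k - l))) \<le> 4 * \<bar>s\<bar> powr \<gamma> * cmod (w a l * w b (k - l))"
        by (simp add: w_def norm_mult mult_ac)
    qed
    also have "\<dots> = cmod (of_real (4 * \<bar>s\<bar> powr \<gamma>) * conv (w a) (w b) k)"
    proof -
      have "conv (w a) (w b) k = complex_of_real (\<Sum>\<^sub>\<infinity>l. cmod (w a l * w b (k - l)))"
        unfolding conv_def
      proof (rule infsumI)
        show "((\<lambda>l. w a l * w b (k - l)) has_sum of_real (\<Sum>\<^sub>\<infinity>l. cmod (w a l * w b (k - l)))) UNIV"
          using has_sum_of_real[OF has_sum_infsum[OF s2], where 'a=complex]
          by (simp add: w_def norm_mult)
      qed
      then show ?thesis by (simp add: infsum_cmult_right' norm_mult infsum_nonneg)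
    qed
    finally show "cmod (flow (- s) (conv (flow s a) (flow s b)) k - conv a b k)
        \<le> cmod (of_real (4 * \<bar>s\<bar> powr \<gamma>) * conv (w a) (w b) k)" .
  qed
qed

text \<open>The phase estimate loses \<open>\<gamma>\<close> derivatives. Iterating it over several factors needs the algebra
property both in \<open>H\<^sup>r\<close>, where errors are measured, and in \<open>H\<^bsup>r+\<gamma>\<^esup>\<close>, where partial products stay bounded.\<close>

locale sobolev_algebra_pair = lo: sobolev_algebra r C K torus + hi: sobolev_algebra "r + \<gamma>" C' K' torus
  for r C K \<gamma> C' K' :: real and torus :: "'d::finite itself" +
  assumes \<gamma>: "0 < \<gamma>" "\<gamma> \<le> 1"
begin

lemma lower: "sobolev_le (r + \<gamma>) x X \<Longrightarrow> sobolev_le r (x :: int ^ 'd \<Rightarrow> complex) X"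
  by (erule sobolev_le_lower_index) (use \<gamma> in simp)

lemma pow_phase_bound:
  "\<exists>L\<ge>0. \<forall>(a :: int ^ 'd \<Rightarrow> complex) s. sobolev_le (r + \<gamma>) a A
     \<longrightarrow> sobolev_le r (\<lambda>k. flow (- s) (conv_pow (flow s a) n) k - conv_pow a n k) (L * \<bar>s\<bar> powr \<gamma>)"
proof (induction n)
  case 0
  have "flow s unit_seq = (unit_seq :: int ^ 'd \<Rightarrow> complex)" for s
    by (auto simp: flow_def unit_seq_def)
  then show ?case by (auto intro!: exI[of _ 0] simp: sobolev_le_def L2_set_def)
next
  case (Suc n)
  then obtain L where L: "L \<ge> 0" "\<And>(a :: int ^ 'd \<Rightarrow> complex) s. sobolev_le (r + \<gamma>) a A
     \<Longrightarrow> sobolev_le r (\<lambda>k. flow (- s) (conv_pow (flow s a) n) k - conv_pow a n k) (L * \<bar>s\<bar> powr \<gamma>)" by blast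
  obtain B where B: "\<And>a :: int ^ 'd \<Rightarrow> complex. sobolev_le (r + \<gamma>) a A \<Longrightarrow> sobolev_le (r + \<gamma>) (conv_pow a n) B"
    using hi.conv_pow_bound[of A n] by blast
  let ?L = "4 * C * A * B + C * A * L"
  have "sobolev_le r (\<lambda>k. flow (- s) (conv_pow (flow s a) (Suc n)) k - conv_pow a (Suc n) k) (\<bar>?L\<bar> * \<bar>s\<bar> powr \<gamma>)"
    if a: "sobolev_le (r + \<gamma>) a A" for a :: "int ^ 'd \<Rightarrow> complex" and s
  proof -
    \<comment> \<open>G is again bounded in the high norm because the flow is an isometry, so the two-factor estimate applies to a and G.\<close>
    define G where "G = flow (- s) (conv_pow (flow s a) n)"
    have G: "sobolev_le (r + \<gamma>) G B" unfolding G_def sobolev_le_flow by (rule B) (use a in simp)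
    have "sobolev_le r (\<lambda>k. flow (- s) (conv (flow s a) (flow s G)) k - conv a (conv_pow a n) k)
       (4 * C * \<bar>s\<bar> powr \<gamma> * A * B + C * A * (L * \<bar>s\<bar> powr \<gamma>))"
      by (rule sobolev_le_triangle[OF lo.bilinear_phase_bound[OF \<gamma> a G]
            lo.conv_diff_right_bound[OF lower[OF a] lower[OF G] lower[OF B[OF a]] L(2)[of a s, OF a, folded G_def]]])
    then have "sobolev_le r (\<lambda>k. flow (- s) (conv (flow s a) (flow s G)) k - conv a (conv_pow a n) k) (\<bar>?L\<bar> * \<bar>s\<bar> powr \<gamma>)"
      by (rule sobolev_le_mono) (use mult_right_mono[OF abs_ge_self[of ?L], of "\<bar>s\<bar> powr \<gamma>"] in \<open>simp add: algebra_simps\<close>)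
    then show ?thesis by (simp add: G_def)
  qed
  then show ?case by (intro exI[of _ "\<bar>?L\<bar>"]) auto
qed

text \<open>Write \<open>u\<close>, \<open>ub\<close> for the transformed solution and its conjugate at time \<open>t\<close>. At time \<open>t + s\<close> the
nonlinearity is \<open>e\<^bsup>-is\<Delta>\<^esup>[e\<^bsup>is\<Delta>\<^esup>P \<cdot> e\<^bsup>-is\<Delta>\<^esup>Q]\<close> up to \<open>e\<^bsup>-it\<Delta>\<^esup>\<close>, where \<open>P \<approx> u\<^bsup>p+1\<^esup>\<close> and \<open>Q \<approx> ub\<^sup>p\<close>
by \<open>pow_phase_bound\<close>. The second factor equals \<open>e\<^bsup>is\<Delta>\<^esup>(e\<^bsup>-2is\<Delta>\<^esup>Q)\<close>, which has the form required by
\<open>bilinear_phase_bound\<close>; hence the product is close to \<open>P \<cdot> e\<^bsup>-2is\<Delta>\<^esup>Q\<close>, and the operator \<open>e\<^bsup>-2is\<Delta>\<^esup>\<close> is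
exactly the one which the method integrates without approximation.\<close>

lemma twisted_product_freezing:
  "\<exists>L\<ge>0. \<forall>(a :: int ^ 'd \<Rightarrow> complex) t s. sobolev_le (r + \<gamma>) a A
     \<longrightarrow> sobolev_le r (\<lambda>k. twisted_product p (t + s) (\<lambda>_. 1) a k
            - twisted_product p t (\<lambda>k. cis (2 * s * (norm (freq k))\<^sup>2)) a k) (L * \<bar>s\<bar> powr \<gamma>)"
proof -
  obtain B1 B2 where B: "\<And>a :: int ^ 'd \<Rightarrow> complex. sobolev_le (r + \<gamma>) a A \<Longrightarrow> sobolev_le (r + \<gamma>) (conv_pow a (p + 1)) B1"
    "\<And>a :: int ^ 'd \<Rightarrow> complex. sobolev_le (r + \<gamma>) a A \<Longrightarrow> sobolev_le (r + \<gamma>) (conv_pow a p) B2"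
    using hi.conv_pow_bound[of A "p + 1"] hi.conv_pow_bound[of A p] by blast
  obtain L1 L2 where L:
    "\<And>(a :: int ^ 'd \<Rightarrow> complex) s. sobolev_le (r + \<gamma>) a A
     \<Longrightarrow> sobolev_le r (\<lambda>k. flow (- s) (conv_pow (flow s a) (p + 1)) k - conv_pow a (p + 1) k) (L1 * \<bar>s\<bar> powr \<gamma>)"
    "\<And>(a :: int ^ 'd \<Rightarrow> complex) s. sobolev_le (r + \<gamma>) a A
     \<Longrightarrow> sobolev_le r (\<lambda>k. flow (- s) (conv_pow (flow s a) p) k - conv_pow a p k) (L2 * \<bar>s\<bar> powr \<gamma>)"
    using pow_phase_bound[of A "p + 1"] pow_phase_bound[of A p] by blast
  let ?L = "4 * C * B1 * B2 + (C * B2 * L1 + C * B1 * L2)"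
  have "sobolev_le r (\<lambda>k. twisted_product p (t + s) (\<lambda>_. 1) a k
            - twisted_product p t (\<lambda>k. cis (2 * s * (norm (freq k))\<^sup>2)) a k) (\<bar>?L\<bar> * \<bar>s\<bar> powr \<gamma>)"
    if "sobolev_le (r + \<gamma>) a A" for a :: "int ^ 'd \<Rightarrow> complex" and t s
  proof -
    define u where "u = flow t a"
    define ub where "ub = flow (- t) (conj_seq a)"
    define U where "U = conv_pow u (p + 1)"
    define W where "W = conv_pow ub p"
    define P where "P = flow (- s) (conv_pow (flow s u) (p + 1))"
    define Q where "Q = flow s (conv_pow (flow (- s) ub) p)"
    have u: "sobolev_le (r + \<gamma>) u A" "sobolev_le (r + \<gamma>) ub A"
      using that by (auto simp: u_def ub_def sobolev_le_conj_seq)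
    have P: "sobolev_le (r + \<gamma>) P B1" unfolding P_def sobolev_le_flow by (rule B) (use u in simp)
    have Q: "sobolev_le (r + \<gamma>) Q B2" unfolding Q_def sobolev_le_flow by (rule B) (use u in simp)
    have U: "sobolev_le (r + \<gamma>) U B1" unfolding U_def by (rule B) (rule u)
    have W: "sobolev_le (r + \<gamma>) W B2" unfolding W_def by (rule B) (rule u)
    have dP: "sobolev_le r (\<lambda>k. P k - U k) (L1 * \<bar>s\<bar> powr \<gamma>)"
      unfolding P_def U_def by (rule L) (rule u)
    have dQ: "sobolev_le r (\<lambda>k. Q k - W k) (L2 * \<bar>s\<bar> powr \<gamma>)"
      using L(2)[OF u(2), of "- s"] by (simp add: Q_def W_def)
    let ?f = "flow (- (2 * s))"
    have fQ: "sobolev_le r (?f Q) B2" and fW: "sobolev_le r (?f W) B2" using lower[OF Q] lower[OF W] by auto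
    have dfQ: "sobolev_le r (\<lambda>k. ?f Q k - ?f W k) (L2 * \<bar>s\<bar> powr \<gamma>)" using dQ by (simp add: flow_diff)
    have "sobolev_le r (\<lambda>k. flow (- s) (conv (flow s P) (flow s (?f Q))) k - conv U (?f W) k)
       (4 * C * \<bar>s\<bar> powr \<gamma> * B1 * B2 + (C * B2 * (L1 * \<bar>s\<bar> powr \<gamma>) + C * B1 * (L2 * \<bar>s\<bar> powr \<gamma>)))"
    proof (rule sobolev_le_triangle[OF _ sobolev_le_triangle])
      show "sobolev_le r (\<lambda>k. flow (- s) (conv (flow s P) (flow s (?f Q))) k - conv P (?f Q) k)
          (4 * C * \<bar>s\<bar> powr \<gamma> * B1 * B2)"
        by (rule lo.bilinear_phase_bound[OF \<gamma> P]) (use Q in simp)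
      show "sobolev_le r (\<lambda>k. conv P (?f Q) k - conv U (?f Q) k) (C * B2 * (L1 * \<bar>s\<bar> powr \<gamma>))"
        by (rule lo.conv_diff_left_bound[OF fQ lower[OF P] lower[OF U] dP])
      show "sobolev_le r (\<lambda>k. conv U (?f Q) k - conv U (?f W) k) (C * B1 * (L2 * \<bar>s\<bar> powr \<gamma>))"
        by (rule lo.conv_diff_right_bound[OF lower[OF U] fQ fW dfQ])
    qed
    then have *: "sobolev_le r (\<lambda>k. flow (- s) (conv (flow s P) (flow s (?f Q))) k - conv U (?f W) k) (\<bar>?L\<bar> * \<bar>s\<bar> powr \<gamma>)"
      by (rule sobolev_le_mono) (use mult_right_mono[OF abs_ge_self[of ?L], of "\<bar>s\<bar> powr \<gamma>"] in \<open>simp add: algebra_simps\<close>)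
    have 1: "twisted_product p (t + s) (\<lambda>_. 1) a = flow (- t) (flow (- s) (conv (flow s P) (flow s (?f Q))))"
    proof -
      have "flow s P = conv_pow (flow (t + s) a) (p + 1)"
        by (simp add: P_def u_def flow_add add.commute)
      moreover have "flow s (?f Q) = conv_pow (flow (- (t + s)) (conj_seq a)) p"
        by (simp add: Q_def ub_def flow_add add.commute)
      ultimately show ?thesis by (simp add: twisted_product_def flow_add add.commute)
    qed
    have 2: "twisted_product p t (\<lambda>k. cis (2 * s * (norm (freq k))\<^sup>2)) a = flow (- t) (conv U (?f W))"
    proof -
      have "?f W = (\<lambda>k. cis (2 * s * (norm (freq k))\<^sup>2) * conv_pow (flow (- t) (conj_seq a)) p k)"
        by (auto simp: flow_def[of "- (2 * s)"] W_def ub_def)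
      then show ?thesis by (simp add: twisted_product_def U_def u_def)
    qed
    show ?thesis unfolding 1 2 flow_diff sobolev_le_flow by (rule *)
  qed
  then show ?thesis by (intro exI[of _ "\<bar>?L\<bar>"]) auto
qed

end

section \<open>Local error, stability and convergence on Fourier coefficients\<close>

text \<open>Minkowski's inequality for integrals, obtained by duality: pairing with the finite sequence \<open>c\<close>
turns the vector of integrals into the integral of a scalar function, to which the
Cauchy--Schwarz inequality applies pointwise in time.\<close>

lemma sobolev_le_has_integral:
  fixes f :: "real \<Rightarrow> int ^ 'd \<Rightarrow> complex"
  assumes int: "\<And>k. ((\<lambda>s. f s k) has_integral I k) {t1..t2}" and "t1 \<le> t2"
    and B: "\<And>s. s \<in> {t1..t2} \<Longrightarrow> sobolev_le r (f s) B"
  shows "sobolev_le r I ((t2 - t1) * B)"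
  unfolding sobolev_le_def
proof (intro allI impI)
  fix F :: "(int ^ 'd) set" assume F: "finite F"
  have B0: "B \<ge> 0" using sobolev_le_nonneg[OF B[of t1]] \<open>t1 \<le> t2\<close> by simp
  define N where "N = L2_set (\<lambda>k. weight r k * cmod (I k)) F"
  define c where "c = (\<lambda>k. of_real ((weight r k)\<^sup>2) * cnj (I k))"
  have N0: "N \<ge> 0" by (simp add: N_def)
  have "((\<lambda>s. \<Sum>k\<in>F. c k * f s k) has_integral (\<Sum>k\<in>F. c k * I k)) (cbox t1 t2)"
    by (intro has_integral_sum F) (use has_integral_mult_right[OF int] in \<open>auto simp: cbox_interval\<close>)
  moreover have "norm (\<Sum>k\<in>F. c k * f s k) \<le> N * B" if "s \<in> cbox t1 t2" for s
  proof -
    have "norm (\<Sum>k\<in>F. c k * f s k) \<le> (\<Sum>k\<in>F. norm (c k * f s k))"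
      by (rule norm_sum)
    also have "\<dots> = (\<Sum>k\<in>F. \<bar>weight r k * cmod (I k)\<bar> * \<bar>weight r k * cmod (f s k)\<bar>)"
      by (intro sum.cong) (auto simp: c_def norm_mult power2_eq_square abs_mult)
    also have "\<dots> \<le> N * L2_set (\<lambda>k. weight r k * cmod (f s k)) F"
      unfolding N_def by (rule L2_set_mult_ineq)
    also have "\<dots> \<le> N * B"
      using that B F N0 by (intro mult_left_mono sobolev_leD) auto
    finally show ?thesis .
  qed
  ultimately have "norm (\<Sum>k\<in>F. c k * I k) \<le> N * B * measure lborel (cbox t1 t2)"
    by (rule has_integral_bound[rotated]) (use N0 B0 in auto)
  moreover have "(\<Sum>k\<in>F. c k * I k) = of_real (N\<^sup>2)"
  proof -
    have "c k * I k = of_real ((weight r k * cmod (I k))\<^sup>2)" for k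
      unfolding c_def power_mult_distrib of_real_mult
      by (metis complex_norm_square mult.assoc mult.commute)
    moreover have "N\<^sup>2 = (\<Sum>k\<in>F. (weight r k * cmod (I k))\<^sup>2)"
      unfolding N_def L2_set_def by (simp add: sum_nonneg)
    ultimately show ?thesis by simp
  qed
  ultimately have "N * N \<le> N * ((t2 - t1) * B)"
    using \<open>t1 \<le> t2\<close> by (simp add: power2_eq_square mult_ac norm_mult)
  then show "L2_set (\<lambda>k. weight r k * cmod (I k)) F \<le> (t2 - t1) * B"
    unfolding N_def[symmetric] using N0 B0 \<open>t1 \<le> t2\<close> by (cases "N = 0") auto
qed

definition phi_symbol :: "real \<Rightarrow> int ^ 'd \<Rightarrow> complex" where
  "phi_symbol \<tau> k = phi1 (\<i> * of_real (2 * \<tau> * (norm (freq k))\<^sup>2))"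

lemma phi1_integral:
  assumes "\<tau> \<ge> 0"
  shows "((\<lambda>s. cis (s * \<kappa>)) has_integral of_real \<tau> * phi1 (\<i> * of_real (\<tau> * \<kappa>))) {0..\<tau>}"
proof (cases "\<kappa> = 0 \<or> \<tau> = 0")
  case True
  then show ?thesis
  proof
    assume "\<kappa> = 0"
    then show ?thesis
      using has_integral_const_real[of "1::complex" 0 \<tau>] assms by (simp add: phi1_def scaleR_conv_of_real)
  next
    assume "\<tau> = 0"
    then show ?thesis using has_integral_refl(2)[of "\<lambda>s. cis (s * \<kappa>)" "0::real"] by simp
  qed
next
  case False
  have "((\<lambda>s. cis (s * \<kappa>)) has_integral (cis (\<tau> * \<kappa>) / (\<i> * \<kappa>) - cis (0 * \<kappa>) / (\<i> * \<kappa>))) {0..\<tau>}"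
  proof (rule fundamental_theorem_of_calculus[OF assms])
    fix s assume "s \<in> {0..\<tau>}"
    have "((\<lambda>s. exp (\<i> * of_real (s * \<kappa>)) / (\<i> * \<kappa>)) has_vector_derivative
            exp (\<i> * of_real (s * \<kappa>))) (at s within {0..\<tau>})"
      using False
      by (auto intro!: derivative_eq_intros has_vector_derivative_real_field[where f="\<lambda>z. exp (\<i> * (z * of_real \<kappa>)) / (\<i> * \<kappa>)", simplified] simp: field_simps)
    then show "((\<lambda>s. cis (s * \<kappa>) / (\<i> * \<kappa>)) has_vector_derivative cis (s * \<kappa>)) (at s within {0..\<tau>})"
      by (simp add: cis_conv_exp)
  qed
  moreover have "cis (\<tau> * \<kappa>) / (\<i> * \<kappa>) - cis (0 * \<kappa>) / (\<i> * \<kappa>) = of_real \<tau> * phi1 (\<i> * of_real (\<tau> * \<kappa>))"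
    using False by (simp add: phi1_def cis_conv_exp field_simps)
  ultimately show ?thesis by simp
qed

text \<open>The function \<open>\<phi>\<^sub>1\<close> is the time average of the retained phase. Uniform convergence in \<open>s\<close> of the series
defining the convolution, by the Weierstrass test, allows termwise integration.\<close>

lemma conv_phi_integral:
  fixes a b :: "int ^ 'd \<Rightarrow> complex"
  assumes "\<tau> \<ge> 0" "l1_le a A" "\<And>k. cmod (b k) \<le> B"
  shows "((\<lambda>s. conv a (\<lambda>k. cis (2 * s * (norm (freq k))\<^sup>2) * b k) k) has_integral
           of_real \<tau> * conv a (\<lambda>k. phi_symbol \<tau> k * b k) k) {0..\<tau>}"
proof -
  let ?g = "\<lambda>l s. a l * (cis (2 * s * (norm (freq (k - l)))\<^sup>2) * b (k - l))"
  let ?J = "\<lambda>l. a l * (of_real \<tau> * phi_symbol \<tau> (k - l) * b (k - l))"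
  have "uniform_limit {0..\<tau>} (\<lambda>G s. \<Sum>l\<in>G. ?g l s) (\<lambda>s. \<Sum>\<^sub>\<infinity>l. ?g l s) (finite_subsets_at_top UNIV)"
  proof (rule Weierstrass_m_test_general)
    show "(\<lambda>l. cmod (a l * b (k - l))) summable_on UNIV"
      by (rule conv_abs_summable[OF l1_le_summable[OF assms(2)] assms(3)])
  qed (simp add: norm_mult)
  moreover have "continuous_on {0..\<tau>} (\<lambda>s. \<Sum>l\<in>G. ?g l s)" for G
    by (intro continuous_intros)
  ultimately obtain I J where I: "\<And>G. ((\<lambda>s. \<Sum>l\<in>G. ?g l s) has_integral I G) {0..\<tau>}"
    and J: "((\<lambda>s. \<Sum>\<^sub>\<infinity>l. ?g l s) has_integral J) {0..\<tau>}" and lim: "(I \<longlongrightarrow> J) (finite_subsets_at_top UNIV)"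
    by (rule uniform_limit_integral) auto
  have IG: "I G = (\<Sum>l\<in>G. ?J l)" if "finite G" for G
  proof (rule has_integral_unique[OF I])
    show "((\<lambda>s. \<Sum>l\<in>G. ?g l s) has_integral (\<Sum>l\<in>G. ?J l)) {0..\<tau>}"
    proof (intro has_integral_sum that)
      fix l
      have "((\<lambda>s. cis (s * (2 * (norm (freq (k - l)))\<^sup>2))) has_integral
          of_real \<tau> * phi_symbol \<tau> (k - l)) {0..\<tau>}"
        using phi1_integral[OF assms(1), of "2 * (norm (freq (k - l)))\<^sup>2"]
        by (simp add: phi_symbol_def mult_ac)
      from has_integral_mult_right[OF has_integral_mult_left[OF this, of "b (k - l)"], of "a l"]
      show "(?g l has_integral ?J l) {0..\<tau>}" by (simp add: mult_ac)
    qed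
  qed
  have "(?J has_sum J) UNIV"
    unfolding has_sum_def
    by (rule Lim_transform_eventually[OF lim]) (auto intro!: eventually_finite_subsets_at_top_weakI IG)
  then have "J = (\<Sum>\<^sub>\<infinity>l. ?J l)" by (simp add: infsumI)
  also have "\<dots> = of_real \<tau> * conv a (\<lambda>k. phi_symbol \<tau> k * b k) k"
    unfolding conv_def infsum_cmult_right'[symmetric] by (simp add: mult_ac)
  finally show ?thesis using J by (simp add: conv_def)
qed

text \<open>The integral equation is imposed between any two times because the local error is measured on one
time interval of the method at a time.\<close>

definition duhamel_solution ::
  "nat \<Rightarrow> real \<Rightarrow> real \<Rightarrow> (real \<Rightarrow> int ^ 'd \<Rightarrow> complex) \<Rightarrow> bool" where
  "duhamel_solution p \<mu> T V \<longleftrightarrow> (\<forall>k t1 t2. 0 \<le> t1 \<and> t1 \<le> t2 \<and> t2 \<le> T \<longrightarrow>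
     ((\<lambda>s. - (\<i> * of_real \<mu> * twisted_product p s (\<lambda>_. 1) (V s) k)) has_integral (V t2 k - V t1 k)) {t1..t2})"

definition scheme_step :: "nat \<Rightarrow> real \<Rightarrow> real \<Rightarrow> real \<Rightarrow> (int ^ 'd \<Rightarrow> complex) \<Rightarrow> int ^ 'd \<Rightarrow> complex" where
  "scheme_step p \<mu> \<tau> t a k = a k - \<i> * of_real \<mu> * of_real \<tau> * twisted_product p t (phi_symbol \<tau>) a k"

primrec scheme_seq ::
  "nat \<Rightarrow> real \<Rightarrow> real \<Rightarrow> (int ^ 'd \<Rightarrow> complex) \<Rightarrow> nat \<Rightarrow> int ^ 'd \<Rightarrow> complex" where
  "scheme_seq p \<mu> \<tau> a 0 = a"
| "scheme_seq p \<mu> \<tau> a (Suc n) = scheme_step p \<mu> \<tau> (real n * \<tau>) (scheme_seq p \<mu> \<tau> a n)"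

lemma norm_phi_symbol: "cmod (phi_symbol \<tau> k) \<le> 1"
  unfolding phi_symbol_def by (rule norm_phi1_le)

context sobolev_algebra
begin

lemma twisted_product_phi_integral:
  assumes "\<tau> \<ge> 0" "sobolev_le r (a :: int ^ 'd \<Rightarrow> complex) A"
  shows "((\<lambda>s. twisted_product p t (\<lambda>k. cis (2 * (s - t) * (norm (freq k))\<^sup>2)) a k) has_integral
           of_real \<tau> * twisted_product p t (phi_symbol \<tau>) a k) {t..t + \<tau>}"
proof -
  let ?P = "conv_pow (flow t a) (p + 1)" and ?Q = "conv_pow (flow (- t) (conj_seq a)) p"
  obtain B1 where "\<And>a :: int ^ 'd \<Rightarrow> complex. sobolev_le r a A \<Longrightarrow> sobolev_le r (conv_pow a (p + 1)) B1"
    using conv_pow_bound[of A "p + 1"] by blast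
  then have P: "sobolev_le r ?P B1" using assms(2) by simp
  obtain B2 where "\<And>a :: int ^ 'd \<Rightarrow> complex. sobolev_le r a A \<Longrightarrow> sobolev_le r (conv_pow a p) B2"
    using conv_pow_bound[of A p] by blast
  then have Q: "sobolev_le r ?Q B2" using assms(2) by (simp add: sobolev_le_conj_seq)
  have "((\<lambda>s. conv ?P (\<lambda>k. cis (2 * s * (norm (freq k))\<^sup>2) * ?Q k) k) has_integral
           of_real \<tau> * conv ?P (\<lambda>k. phi_symbol \<tau> k * ?Q k) k) {0..\<tau>}"
    by (rule conv_phi_integral[OF assms(1) l1_bound[OF P] sobolev_le_bounded[OF Q r_nonneg]])
  then have "((\<lambda>s. cis (t * (norm (freq k))\<^sup>2) * conv ?P (\<lambda>k. cis (2 * s * (norm (freq k))\<^sup>2) * ?Q k) k) has_integral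
           cis (t * (norm (freq k))\<^sup>2) * (of_real \<tau> * conv ?P (\<lambda>k. phi_symbol \<tau> k * ?Q k) k)) {0..\<tau>}"
    by (rule has_integral_mult_right)
  then have "((\<lambda>s. twisted_product p t (\<lambda>k. cis (2 * s * (norm (freq k))\<^sup>2)) a k) has_integral
           of_real \<tau> * twisted_product p t (phi_symbol \<tau>) a k) {0..\<tau>}"
    by (simp add: twisted_product_def flow_def[of "- t" "conv _ _"] mult_ac)
  then show ?thesis
    using has_integral_shift_Icc_real[of "\<lambda>s. twisted_product p t (\<lambda>k. cis (2 * (s - t) * (norm (freq k))\<^sup>2)) a k"
        t _ 0 \<tau>] by (simp add: o_def add.commute)
qed

lemma scheme_step_stable:
  "\<exists>L\<ge>0. \<forall>(a :: int ^ 'd \<Rightarrow> complex) b D \<tau> t.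
     sobolev_le r a A \<and> sobolev_le r b A \<and> sobolev_le r (\<lambda>k. a k - b k) D \<and> \<tau> \<ge> 0
     \<longrightarrow> sobolev_le r (\<lambda>k. scheme_step p \<mu> \<tau> t a k - scheme_step p \<mu> \<tau> t b k) ((1 + L * \<tau>) * D)"
proof -
  obtain L where L: "L \<ge> 0" "\<And>(a :: int ^ 'd \<Rightarrow> complex) b D t m.
     sobolev_le r a A \<Longrightarrow> sobolev_le r b A \<Longrightarrow> sobolev_le r (\<lambda>k. a k - b k) D \<Longrightarrow> (\<And>k. cmod (m k) \<le> 1)
     \<Longrightarrow> sobolev_le r (\<lambda>k. twisted_product p t m a k - twisted_product p t m b k) (L * D)"
    using twisted_product_lipschitz[of A p] by blast
  have "sobolev_le r (\<lambda>k. scheme_step p \<mu> \<tau> t a k - scheme_step p \<mu> \<tau> t b k) ((1 + \<bar>\<mu>\<bar> * L * \<tau>) * D)"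
    if a: "sobolev_le r a A" "sobolev_le r b A" "sobolev_le r (\<lambda>k. a k - b k) D" and \<tau>: "\<tau> \<ge> 0"
    for a b :: "int ^ 'd \<Rightarrow> complex" and D \<tau> t
  proof -
    have "sobolev_le r (\<lambda>k. (a k - b k) - \<i> * of_real \<mu> * of_real \<tau> *
        (twisted_product p t (phi_symbol \<tau>) a k - twisted_product p t (phi_symbol \<tau>) b k))
       (D + cmod (\<i> * of_real \<mu> * of_real \<tau>) * (L * D))"
      by (intro sobolev_le_diff sobolev_le_scale L a norm_phi_symbol)
    then show ?thesis using \<tau> by (simp add: scheme_step_def algebra_simps norm_mult)
  qed
  then show ?thesis using L(1) by (intro exI[of _ "\<bar>\<mu>\<bar> * L"]) auto
qed

end

context sobolev_algebra_pair
begin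

text \<open>Within one time interval the exact integrand is altered twice. Replacing \<open>V s\<close> by \<open>V t\<close> costs \<open>O(s - t)\<close>,
since the solution is Lipschitz in time; freezing the oscillations costs \<open>O((s - t)\<^sup>\<gamma>)\<close>. Both are
\<open>O(\<tau>\<^sup>\<gamma>)\<close> for \<open>\<tau> \<le> 1\<close>, and integrating over the interval gains one more power of \<open>\<tau>\<close>.\<close>

lemma local_error:
  "\<exists>K\<ge>0. \<forall>(V :: real \<Rightarrow> int ^ 'd \<Rightarrow> complex) t \<tau>.
     duhamel_solution p \<mu> T V \<and> (\<forall>s\<in>{0..T}. sobolev_le (r + \<gamma>) (V s) M) \<and> 0 \<le> t \<and> 0 < \<tau> \<and> \<tau> \<le> 1 \<and> t + \<tau> \<le> T
     \<longrightarrow> sobolev_le r (\<lambda>k. V (t + \<tau>) k - scheme_step p \<mu> \<tau> t (V t) k) (\<tau> * (K * \<tau> powr \<gamma>))"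
proof -
  obtain B where B: "\<And>(a :: int ^ 'd \<Rightarrow> complex) t m. sobolev_le r a M \<Longrightarrow> (\<And>k. cmod (m k) \<le> 1)
     \<Longrightarrow> sobolev_le r (twisted_product p t m a) B"
    using lo.twisted_product_bound[of M p] by blast
  obtain L where L: "L \<ge> 0" "\<And>(a :: int ^ 'd \<Rightarrow> complex) b D t m.
     sobolev_le r a M \<Longrightarrow> sobolev_le r b M \<Longrightarrow> sobolev_le r (\<lambda>k. a k - b k) D \<Longrightarrow> (\<And>k. cmod (m k) \<le> 1)
     \<Longrightarrow> sobolev_le r (\<lambda>k. twisted_product p t m a k - twisted_product p t m b k) (L * D)"
    using lo.twisted_product_lipschitz[of M p] by blast
  obtain K where K: "K \<ge> 0" "\<And>(a :: int ^ 'd \<Rightarrow> complex) t s. sobolev_le (r + \<gamma>) a M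
     \<Longrightarrow> sobolev_le r (\<lambda>k. twisted_product p (t + s) (\<lambda>_. 1) a k
            - twisted_product p t (\<lambda>k. cis (2 * s * (norm (freq k))\<^sup>2)) a k) (K * \<bar>s\<bar> powr \<gamma>)"
    using twisted_product_freezing[of M p] by blast
  let ?B = "\<bar>B\<bar>"
  let ?K = "\<bar>\<mu>\<bar> * (L * (\<bar>\<mu>\<bar> * ?B) + K)"
  have "sobolev_le r (\<lambda>k. V (t + \<tau>) k - scheme_step p \<mu> \<tau> t (V t) k) (\<tau> * (?K * \<tau> powr \<gamma>))"
    if V: "duhamel_solution p \<mu> T V" "\<And>s. s \<in> {0..T} \<Longrightarrow> sobolev_le (r + \<gamma>) (V s) M"
      and t: "0 \<le> t" "0 < \<tau>" "\<tau> \<le> 1" "t + \<tau> \<le> T"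
    for V :: "real \<Rightarrow> int ^ 'd \<Rightarrow> complex" and t \<tau>
  proof -
    let ?N = "\<lambda>s. twisted_product p s (\<lambda>_. 1) (V s)"
    let ?Z = "\<lambda>s. twisted_product p t (\<lambda>k. cis (2 * (s - t) * (norm (freq k))\<^sup>2)) (V t)"
    have Vr: "sobolev_le r (V s) M" if "s \<in> {0..T}" for s
      using lower[OF V(2)[OF that]] .
    have int: "((\<lambda>s. - (\<i> * of_real \<mu> * ?N s k)) has_integral (V s2 k - V s1 k)) {s1..s2}"
      if "0 \<le> s1" "s1 \<le> s2" "s2 \<le> T" for s1 s2 k
      using V(1) that by (auto simp: duhamel_solution_def)
    have lip: "sobolev_le r (\<lambda>k. V s k - V t k) ((s - t) * (\<bar>\<mu>\<bar> * ?B))" if s: "s \<in> {t..t + \<tau>}" for s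
    proof (rule sobolev_le_has_integral[OF int])
      fix s' assume "s' \<in> {t..s}"
      then have "sobolev_le r (?N s') ?B"
        using s t by (intro sobolev_le_mono[OF B[OF Vr]]) auto
      from sobolev_le_scale[OF this, of "- (\<i> * of_real \<mu>)"]
      show "sobolev_le r (\<lambda>k. - (\<i> * of_real \<mu> * ?N s' k)) (\<bar>\<mu>\<bar> * ?B)"
        by (simp add: norm_mult)
    qed (use s t in auto)
    have diff: "sobolev_le r (\<lambda>k. - (\<i> * of_real \<mu>) * (?N s k - ?Z s k)) (?K * \<tau> powr \<gamma>)"
      if s: "s \<in> {t..t + \<tau>}" for s
    proof -
      have sT: "s \<in> {0..T}" "t \<in> {0..T}" using s t by auto
      have "sobolev_le r (\<lambda>k. ?N s k - twisted_product p s (\<lambda>_. 1) (V t) k) (L * ((s - t) * (\<bar>\<mu>\<bar> * ?B)))"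
        by (rule L(2)[OF Vr[OF sT(1)] Vr[OF sT(2)] lip[OF s]]) simp
      moreover have "sobolev_le r (\<lambda>k. twisted_product p s (\<lambda>_. 1) (V t) k - ?Z s k) (K * \<bar>s - t\<bar> powr \<gamma>)"
        using K(2)[OF V(2)[OF sT(2)], of t "s - t"] by simp
      ultimately have "sobolev_le r (\<lambda>k. ?N s k - ?Z s k) (L * ((s - t) * (\<bar>\<mu>\<bar> * ?B)) + K * \<bar>s - t\<bar> powr \<gamma>)"
        by (rule sobolev_le_triangle)
      then have "sobolev_le r (\<lambda>k. ?N s k - ?Z s k) ((L * (\<bar>\<mu>\<bar> * ?B) + K) * \<tau> powr \<gamma>)"
      proof (rule sobolev_le_mono)
        have pw: "\<bar>s - t\<bar> powr \<gamma> \<le> \<tau> powr \<gamma>"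
          using s \<gamma> by (intro powr_mono2) auto
        have "s - t \<le> \<tau> powr 1" using s t by simp
        also have "\<dots> \<le> \<tau> powr \<gamma>" using \<gamma> t by (intro powr_mono') auto
        finally have "L * ((s - t) * (\<bar>\<mu>\<bar> * ?B)) \<le> L * (\<tau> powr \<gamma> * (\<bar>\<mu>\<bar> * ?B))"
          using L(1) by (intro mult_left_mono mult_right_mono) auto
        then show "L * ((s - t) * (\<bar>\<mu>\<bar> * ?B)) + K * \<bar>s - t\<bar> powr \<gamma> \<le> (L * (\<bar>\<mu>\<bar> * ?B) + K) * \<tau> powr \<gamma>"
          using mult_left_mono[OF pw K(1)] by (simp add: algebra_simps)
      qed
      from sobolev_le_scale[OF this, of "- (\<i> * of_real \<mu>)"] show ?thesis
        by (simp add: norm_mult mult.assoc)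
    qed
    have tT: "t \<in> {0..T}" using t by auto
    have "sobolev_le r (\<lambda>k. (V (t + \<tau>) k - V t k) - - (\<i> * of_real \<mu>) * (of_real \<tau> * twisted_product p t (phi_symbol \<tau>) (V t) k))
       ((t + \<tau> - t) * (?K * \<tau> powr \<gamma>))"
    proof (rule sobolev_le_has_integral[OF _ _ diff])
      fix k
      have "((\<lambda>s. - (\<i> * of_real \<mu>) * ?Z s k) has_integral
          - (\<i> * of_real \<mu>) * (of_real \<tau> * twisted_product p t (phi_symbol \<tau>) (V t) k)) {t..t + \<tau>}"
        by (intro has_integral_mult_right lo.twisted_product_phi_integral[OF _ Vr[OF tT]]) (use t in auto)
      moreover have "((\<lambda>s. - (\<i> * of_real \<mu> * ?N s k)) has_integral (V (t + \<tau>) k - V t k)) {t..t + \<tau>}"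
        by (rule int) (use t in auto)
      ultimately have "((\<lambda>s. - (\<i> * of_real \<mu> * ?N s k) - - (\<i> * of_real \<mu>) * ?Z s k) has_integral
          (V (t + \<tau>) k - V t k) - - (\<i> * of_real \<mu>) * (of_real \<tau> * twisted_product p t (phi_symbol \<tau>) (V t) k))
          {t..t + \<tau>}"
        by (rule has_integral_diff[rotated])
      then show "((\<lambda>s. - (\<i> * of_real \<mu>) * (?N s k - ?Z s k)) has_integral
          (V (t + \<tau>) k - V t k) - - (\<i> * of_real \<mu>) * (of_real \<tau> * twisted_product p t (phi_symbol \<tau>) (V t) k))
          {t..t + \<tau>}"
        by (simp add: algebra_simps)
    qed (use t in auto)
    then show ?thesis by (simp add: scheme_step_def algebra_simps)
  qed
  moreover have "?K \<ge> 0" using L K by simp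
  ultimately show ?thesis by (intro exI[of _ ?K]) blast
qed

text \<open>Stability transports the local errors to the final time. The stability constant is available only on
balls of \<open>H\<^sup>r\<close>, so the induction also keeps the numerical solution in the ball of radius \<open>M + 1\<close>.\<close>

lemma scheme_convergence:
  assumes "T > 0"
  shows "\<exists>c\<ge>0. \<forall>V :: real \<Rightarrow> int ^ 'd \<Rightarrow> complex.
     duhamel_solution p \<mu> T V \<and> (\<forall>s\<in>{0..T}. sobolev_le (r + \<gamma>) (V s) M) \<longrightarrow>
     (\<exists>\<tau>0>0. \<forall>\<tau> n. 0 < \<tau> \<and> \<tau> \<le> \<tau>0 \<and> real n * \<tau> \<le> T \<longrightarrow>
        sobolev_le r (\<lambda>k. V (real n * \<tau>) k - scheme_seq p \<mu> \<tau> (V 0) n k) (c * \<tau> powr \<gamma>))"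
proof -
  obtain K where K: "K \<ge> 0" "\<And>(V :: real \<Rightarrow> int ^ 'd \<Rightarrow> complex) t \<tau>.
     duhamel_solution p \<mu> T V \<Longrightarrow> (\<And>s. s \<in> {0..T} \<Longrightarrow> sobolev_le (r + \<gamma>) (V s) M) \<Longrightarrow> 0 \<le> t \<Longrightarrow> 0 < \<tau> \<Longrightarrow> \<tau> \<le> 1
     \<Longrightarrow> t + \<tau> \<le> T \<Longrightarrow> sobolev_le r (\<lambda>k. V (t + \<tau>) k - scheme_step p \<mu> \<tau> t (V t) k) (\<tau> * (K * \<tau> powr \<gamma>))"
    using local_error[of p \<mu> T M] by blast
  obtain L where L: "L \<ge> 0" "\<And>(a :: int ^ 'd \<Rightarrow> complex) b D \<tau> t.
     sobolev_le r a (M + 1) \<Longrightarrow> sobolev_le r b (M + 1) \<Longrightarrow> sobolev_le r (\<lambda>k. a k - b k) D \<Longrightarrow> \<tau> \<ge> 0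
     \<Longrightarrow> sobolev_le r (\<lambda>k. scheme_step p \<mu> \<tau> t a k - scheme_step p \<mu> \<tau> t b k) ((1 + L * \<tau>) * D)"
    using lo.scheme_step_stable[of "M + 1" p \<mu>] by blast
  define c where "c = T * K * exp (L * T)"
  have c0: "c \<ge> 0" using K(1) assms by (simp add: c_def)
  \<comment> \<open>Chosen such that the error bound is at most 1 whenever the time increment is at most tau0.\<close>
  define \<tau>0 where "\<tau>0 = min 1 ((1 / (c + 1)) powr (1 / \<gamma>))"
  have \<tau>0: "\<tau>0 > 0" using c0 by (simp add: \<tau>0_def)
  have main: "sobolev_le r (\<lambda>k. V (real n * \<tau>) k - scheme_seq p \<mu> \<tau> (V 0) n k) (c * \<tau> powr \<gamma>)"
    if V: "duhamel_solution p \<mu> T V" "\<And>s. s \<in> {0..T} \<Longrightarrow> sobolev_le (r + \<gamma>) (V s) M"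
      and \<tau>: "0 < \<tau>" "\<tau> \<le> \<tau>0" and n: "real n * \<tau> \<le> T"
    for V :: "real \<Rightarrow> int ^ 'd \<Rightarrow> complex" and \<tau> n
  proof -
    have \<tau>1: "\<tau> \<le> 1" using \<tau> by (simp add: \<tau>0_def)
    have small: "c * \<tau> powr \<gamma> \<le> 1"
    proof -
      have "\<tau> powr \<gamma> \<le> ((1 / (c + 1)) powr (1 / \<gamma>)) powr \<gamma>"
        using \<tau> \<gamma> by (intro powr_mono2) (auto simp: \<tau>0_def)
      also have "\<dots> = 1 / (c + 1)" using \<gamma> c0 by (simp add: powr_powr)
      finally have "c * \<tau> powr \<gamma> \<le> c * (1 / (c + 1))" using c0 by (rule mult_left_mono)
      also have "\<dots> \<le> 1" using c0 by simp
      finally show ?thesis .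
    qed
    \<comment> \<open>A closed form that dominates the recursion e (n+1) = (1 + L tau) e n + K tau powr (1 + gamma).\<close>
    define e where "e = (\<lambda>n. (real n * \<tau>) * K * exp (L * (real n * \<tau>)) * \<tau> powr \<gamma>)"
    have ec: "e n \<le> c * \<tau> powr \<gamma>" if "real n * \<tau> \<le> T" for n
      unfolding e_def c_def using that K(1) L(1) \<tau> assms
      by (intro mult_right_mono mult_mono) (auto intro: mult_left_mono)
    have "sobolev_le r (\<lambda>k. V (real n * \<tau>) k - scheme_seq p \<mu> \<tau> (V 0) n k) (e n)"
      if "real n * \<tau> \<le> T" for n using that
    proof (induction n)
      case 0
      then show ?case by (simp add: e_def sobolev_le_def L2_set_def)
    next
      case (Suc n)
      let ?t = "real n * \<tau>" and ?W = "scheme_seq p \<mu> \<tau> (V 0) n"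
      have t: "0 \<le> ?t" "?t + \<tau> \<le> T" using Suc.prems \<tau> by (auto simp: algebra_simps)
      have tT: "?t \<le> T" using t \<tau> by linarith
      note IH = Suc.IH[OF tT]
      have Vt: "sobolev_le r (V ?t) M" by (rule lower[OF V(2)]) (use t tT in auto)
      have "sobolev_le r (\<lambda>k. V ?t k - (V ?t k - ?W k)) (M + e n)"
        by (rule sobolev_le_diff[OF Vt IH])
      then have "sobolev_le r ?W (M + e n)" by simp
      then have W: "sobolev_le r ?W (M + 1)"
        by (rule sobolev_le_mono) (use ec[OF tT] small in simp)
      have "sobolev_le r (\<lambda>k. V (?t + \<tau>) k - scheme_step p \<mu> \<tau> ?t ?W k) (\<tau> * (K * \<tau> powr \<gamma>) + (1 + L * \<tau>) * e n)"
        by (rule sobolev_le_triangle[OF K(2)[OF V t(1) \<tau>(1) \<tau>1 t(2)] L(2)[OF sobolev_le_mono[OF Vt] W IH]])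
           (use \<tau> in auto)
      moreover have "\<tau> * (K * \<tau> powr \<gamma>) + (1 + L * \<tau>) * e n \<le> e (Suc n)"
      proof -
        have "(1 + L * \<tau>) * e n \<le> exp (L * \<tau>) * e n"
          using K(1) \<tau> by (intro mult_right_mono) (auto simp: e_def)
        also have "\<dots> = ?t * K * exp (L * (?t + \<tau>)) * \<tau> powr \<gamma>"
          by (simp add: e_def exp_add algebra_simps)
        finally have 1: "(1 + L * \<tau>) * e n \<le> ?t * K * exp (L * (?t + \<tau>)) * \<tau> powr \<gamma>" .
        have "1 \<le> exp (L * (?t + \<tau>))" using L(1) t(1) \<tau> by simp
        then have "\<tau> * (K * \<tau> powr \<gamma>) * 1 \<le> \<tau> * (K * \<tau> powr \<gamma>) * exp (L * (?t + \<tau>))"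
          using K(1) \<tau> by (intro mult_left_mono) auto
        with 1 show ?thesis by (simp add: e_def algebra_simps)
      qed
      ultimately have "sobolev_le r (\<lambda>k. V (?t + \<tau>) k - scheme_step p \<mu> \<tau> ?t ?W k) (e (Suc n))"
        by (rule sobolev_le_mono)
      then show ?case by (simp add: algebra_simps)
    qed
    from this[OF n] ec[OF n] show ?thesis by (rule sobolev_le_mono)
  qed
  show ?thesis
    by (intro exI[of _ c] conjI c0 allI impI exI[of _ \<tau>0] \<tau>0) (use main in blast)
qed

end

section \<open>Fourier series on the torus\<close>

lemma lborel_integral_prod:
  fixes f :: "'a::euclidean_space \<Rightarrow> real \<Rightarrow> complex"
  assumes "\<And>b. b \<in> Basis \<Longrightarrow> integrable lborel (f b)"
  shows "(\<integral>x. (\<Prod>b\<in>Basis. f b (x \<bullet> b)) \<partial>lborel) = (\<Prod>b\<in>Basis. \<integral>x. f b x \<partial>lborel)"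
proof -
  interpret product_sigma_finite "\<lambda>_::'a. lborel :: real measure" ..
  have [measurable]: "f b \<in> borel_measurable borel" if "b \<in> Basis" for b
    using borel_measurable_integrable[OF assms[OF that]] by simp
  have "(\<integral>x. (\<Prod>b\<in>Basis. f b (x \<bullet> b)) \<partial>lborel)
      = (\<integral>x. (\<Prod>b\<in>Basis. f b ((\<Sum>c\<in>Basis. x c *\<^sub>R c) \<bullet> b)) \<partial>(\<Pi>\<^sub>M b\<in>(Basis :: 'a set). lborel))"
    unfolding lborel_eq[where 'a='a] by (subst integral_distr) (auto intro!: borel_measurable_prod)
  also have "\<dots> = (\<integral>x. (\<Prod>b\<in>Basis. f b (x b)) \<partial>(\<Pi>\<^sub>M b\<in>(Basis :: 'a set). lborel))"
    by (intro Bochner_Integration.integral_cong prod.cong refl) simp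
  also have "\<dots> = (\<Prod>b\<in>Basis. \<integral>x. f b x \<partial>lborel)"
    by (rule product_integral_prod) (use assms in auto)
  finally show ?thesis .
qed

lemma integral_cis_period:
  fixes m :: int
  shows "(\<integral>x. indicator {0..2 * pi} x *\<^sub>R cis (real_of_int m * x) \<partial>lborel) = (if m = 0 then of_real (2 * pi) else 0)"
    and "integrable lborel (\<lambda>x. indicator {0..2 * pi} x *\<^sub>R cis (real_of_int m * x))"
proof -
  show i: "integrable lborel (\<lambda>x. indicator {0..2 * pi} x *\<^sub>R cis (real_of_int m * x))"
    by (rule borel_integrable_compact) (auto intro!: continuous_intros)
  have "(\<integral>x. indicator {0..2 * pi} x *\<^sub>R cis (real_of_int m * x) \<partial>lborel)
      = integral {0..2 * pi} (\<lambda>x. cis (real_of_int m * x))"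
    using set_borel_integral_eq_integral(2)[of "{0..2*pi}" "\<lambda>x. cis (real_of_int m * x)"] i
    by (simp add: set_integrable_def set_lebesgue_integral_def)
  also have "\<dots> = of_real (2 * pi) * phi1 (\<i> * of_real (2 * pi * real_of_int m))"
    using phi1_integral[of "2 * pi" "real_of_int m"] by (simp add: mult.commute integral_unique)
  also have "\<dots> = (if m = 0 then of_real (2 * pi) else 0)"
  proof (cases "m = 0")
    case False
    have "exp (\<i> * of_real (2 * pi * real_of_int m)) = cis (2 * pi * real_of_int m)"
      by (simp only: cis_conv_exp)
    also have "\<dots> = 1" by (rule cis_multiple_2pi) simp
    finally show ?thesis using False by (simp add: phi1_def)
  qed (simp add: phi1_def)
  finally show "(\<integral>x. indicator {0..2 * pi} x *\<^sub>R cis (real_of_int m * x) \<partial>lborel) = (if m = 0 then of_real (2 * pi) else 0)" .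
qed

lemma Basis_cart: "(Basis :: (real ^ 'd) set) = range (\<lambda>i. axis i 1)"
  by (auto simp: Basis_vec_def)

text \<open>Orthogonality of the characters: both the indicator of the cell and the character are products over
the coordinates, and a coordinate with nonzero frequency contributes the factor \<open>0\<close>.\<close>

lemma integral_character:
  fixes m :: "int ^ 'd"
  shows "(LINT x:torus_cell|lborel. cis (freq m \<bullet> x)) = (if m = 0 then of_real ((2 * pi) ^ CARD('d)) else 0)"
proof -
  let ?f = "\<lambda>i x. indicator {0..2 * pi} x *\<^sub>R cis (real_of_int (m $ i) * x)"
  define g where "g = (\<lambda>b :: real ^ 'd. \<lambda>x::real. indicator {0..2 * pi} x *\<^sub>R cis ((freq m \<bullet> b) * x))"
  have g: "g (axis i 1) = ?f i" for i
    by (simp add: g_def inner_axis freq_def)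
  have inj: "inj (\<lambda>i::'d. axis i (1::real))"
    by (auto simp: inj_on_def axis_eq_axis)
  have "indicator torus_cell x *\<^sub>R cis (freq m \<bullet> x) = (\<Prod>b\<in>Basis. g b (x \<bullet> b))" for x :: "real ^ 'd"
  proof -
    have "(\<Prod>b\<in>Basis. g b (x \<bullet> b)) = (\<Prod>i\<in>UNIV. ?f i (x $ i))"
      unfolding Basis_cart by (subst prod.reindex[OF inj]) (simp add: g inner_axis)
    also have "\<dots> = (\<Prod>i\<in>UNIV. of_real (indicator {0..2 * pi} (x $ i))) * (\<Prod>i\<in>UNIV. cis (real_of_int (m $ i) * x $ i))"
      by (simp add: prod.distrib scaleR_conv_of_real)
    also have "(\<Prod>i\<in>UNIV. complex_of_real (indicator {0..2 * pi} (x $ i))) = indicator torus_cell x"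
      by (auto simp: torus_cell_def indicator_def mem_box_cart split: if_splits)
    also have "(\<Prod>i\<in>UNIV. cis (real_of_int (m $ i) * x $ i)) = cis (freq m \<bullet> x)"
      by (simp add: cis_conv_exp inner_vec_def freq_def exp_sum sum_distrib_left flip: exp_sum)
    finally show ?thesis by (simp add: indicator_def)
  qed
  then have "(LINT x:torus_cell|lborel. cis (freq m \<bullet> x)) = (\<integral>x. (\<Prod>b\<in>Basis. g b (x \<bullet> b)) \<partial>lborel)"
    by (simp add: set_lebesgue_integral_def)
  also have "\<dots> = (\<Prod>b\<in>Basis. \<integral>x. g b x \<partial>lborel)"
    by (rule lborel_integral_prod) (auto simp: Basis_cart g integral_cis_period)
  also have "\<dots> = (\<Prod>i\<in>UNIV. \<integral>x. ?f i x \<partial>lborel)"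
    unfolding Basis_cart by (subst prod.reindex[OF inj]) (simp add: g)
  also have "\<dots> = (\<Prod>i\<in>UNIV. if m $ i = 0 then of_real (2 * pi) else 0)"
    by (simp only: integral_cis_period)
  also have "\<dots> = (if m = 0 then of_real ((2 * pi) ^ CARD('d)) else 0)"
    by (auto simp: vec_eq_iff)
  finally show ?thesis .
qed

lemma torus_cell_measurable [measurable]: "torus_cell \<in> sets borel"
  by (simp add: torus_cell_def)

lemma emeasure_torus_cell_finite: "emeasure lborel torus_cell < \<infinity>"
  unfolding torus_cell_def by (rule emeasure_lborel_cbox_finite)

lemma measure_torus_cell: "measure lborel (torus_cell :: (real ^ 'd) set) = (2 * pi) ^ CARD('d)"
proof -
  have "complex_of_real (measure lborel (torus_cell :: (real ^ 'd) set)) = of_real ((2 * pi) ^ CARD('d))"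
    using integral_character[of "0 :: int ^ 'd"] emeasure_torus_cell_finite[where 'a='d]
    by (simp add: set_lebesgue_integral_def integral_indicator scaleR_conv_of_real flip: of_real_power)
  then show ?thesis using of_real_eq_iff by blast
qed

lemma set_integrable_bounded_torus:
  assumes [measurable]: "f \<in> borel_measurable borel" and "\<And>x. cmod (f x) \<le> B"
  shows "set_integrable lborel torus_cell f"
  unfolding set_integrable_def
  by (rule integrableI_bounded_set_indicator[where B=B])
     (use assms emeasure_torus_cell_finite in auto)

lemma measurable_character [measurable]: "(\<lambda>x. cis (k \<bullet> x)) \<in> borel_measurable borel"
  by (intro borel_measurable_continuous_onI continuous_intros)

lemma measurable_cnj_character [measurable]: "(\<lambda>x. cis (- (k \<bullet> x))) \<in> borel_measurable borel"
  by (intro borel_measurable_continuous_onI continuous_intros)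

lemma set_integrable_character:
  assumes "set_integrable lborel torus_cell f"
  shows "set_integrable lborel torus_cell (\<lambda>x. f x * cis (- (freq k \<bullet> x)))"
  unfolding set_integrable_def
proof (rule Bochner_Integration.integrable_bound)
  show "integrable lborel (\<lambda>x. indicator torus_cell x *\<^sub>R f x)"
    using assms by (simp add: set_integrable_def)
  then have "(\<lambda>x. (indicator torus_cell x *\<^sub>R f x) * cis (- (freq k \<bullet> x))) \<in> borel_measurable lborel"
    by measurable
  then show "(\<lambda>x. indicator torus_cell x *\<^sub>R (f x * cis (- (freq k \<bullet> x)))) \<in> borel_measurable lborel"
    by simp
qed (auto simp: norm_mult)

lemma fourier_coeff_add_scale:
  assumes "set_integrable lborel torus_cell f" "set_integrable lborel torus_cell g"
  shows "fourier_coeff (\<lambda>x. f x + c * g x) k = fourier_coeff f k + c * fourier_coeff g k"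
proof -
  note i = set_integrable_character[OF assms(1), of k] set_integrable_character[OF assms(2), of k]
  have "(LINT x:torus_cell|lborel. (f x + c * g x) * cis (- (freq k \<bullet> x)))
      = (LINT x:torus_cell|lborel. f x * cis (- (freq k \<bullet> x)) + c * (g x * cis (- (freq k \<bullet> x))))"
    by (simp add: distrib_right mult.assoc)
  also have "\<dots> = (LINT x:torus_cell|lborel. f x * cis (- (freq k \<bullet> x)))
      + (LINT x:torus_cell|lborel. c * (g x * cis (- (freq k \<bullet> x))))"
    by (rule set_integral_add) (use i in auto)
  finally show ?thesis
    by (simp add: fourier_coeff_def add_divide_distrib)
qed

lemma fourier_coeff_diff:
  assumes "set_integrable lborel torus_cell f" "set_integrable lborel torus_cell g"
  shows "fourier_coeff (\<lambda>x. f x - g x) k = fourier_coeff f k - fourier_coeff g k"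
  using fourier_coeff_add_scale[OF assms, of "-1" k] by simp

lemma fourier_coeff_cnj: "fourier_coeff (\<lambda>x. cnj (f x)) = conj_seq (fourier_coeff f)"
proof
  fix k
  have "(LINT x:torus_cell|lborel. cnj (f x) * cis (- (freq k \<bullet> x)))
      = (LINT x:torus_cell|lborel. cnj (f x * cis (- (freq (- k) \<bullet> x))))"
    by (simp add: freq_minus cis_cnj)
  also have "\<dots> = cnj (LINT x:torus_cell|lborel. f x * cis (- (freq (- k) \<bullet> x)))"
    by (simp only: set_lebesgue_integral_def Bochner_Integration.integral_cnj[symmetric] complex_cnj_scaleR)
  finally show "fourier_coeff (\<lambda>x. cnj (f x)) k = conj_seq (fourier_coeff f) k"
    by (simp add: fourier_coeff_def conj_seq_def)
qed

lemma fourier_coeff_bound: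
  fixes f :: "real ^ 'd \<Rightarrow> complex"
  assumes "f \<in> borel_measurable borel" "\<And>x. cmod (f x) \<le> B"
  shows "cmod (fourier_coeff f k) \<le> B"
proof -
  let ?I = "LINT x:torus_cell|lborel. f x * cis (- (freq k \<bullet> x))"
  have "cmod ?I \<le> (LINT x:torus_cell|lborel. cmod (f x * cis (- (freq k \<bullet> x))))"
    by (rule set_integral_norm_bound[OF set_integrable_character[OF set_integrable_bounded_torus[OF assms]]])
  also have "\<dots> \<le> (LINT x:(torus_cell :: (real ^ 'd) set)|lborel. B)"
  proof (rule set_integral_mono)
    show "set_integrable lborel torus_cell (\<lambda>x. cmod (f x * cis (- (freq k \<bullet> x))))"
      by (rule set_integrable_norm[OF set_integrable_character[OF set_integrable_bounded_torus[OF assms]]])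
    show "set_integrable lborel (torus_cell :: (real ^ 'd) set) (\<lambda>x. B)"
      unfolding set_integrable_def using emeasure_torus_cell_finite by (intro integrable_scaleR_left) auto
  qed (use assms in \<open>auto simp: norm_mult\<close>)
  also have "\<dots> = (2 * pi) ^ CARD('d) * B"
    using emeasure_torus_cell_finite[where 'a='d]
    by (simp add: set_lebesgue_integral_def measure_torus_cell power_mult_distrib less_top[symmetric])
  finally show ?thesis
    by (simp add: fourier_coeff_def norm_divide norm_power norm_mult field_simps)
qed

definition fourier_series :: "(int ^ 'd \<Rightarrow> complex) \<Rightarrow> real ^ 'd \<Rightarrow> complex" where
  "fourier_series a x = (\<Sum>\<^sub>\<infinity>k. a k * cis (freq k \<bullet> x))"

lemma laplace_fun_eq:
  "laplace_fun g f = fourier_series (\<lambda>k. g (- (norm (freq k))\<^sup>2) * fourier_coeff f k)"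
  by (simp add: laplace_fun_def fourier_series_def fun_eq_iff)

lemma fourier_series_uniform_limit:
  assumes "l1_le a A"
  shows "uniform_limit UNIV (\<lambda>G x. \<Sum>k\<in>G. a k * cis (freq k \<bullet> x)) (fourier_series a) (finite_subsets_at_top UNIV)"
  unfolding fourier_series_def
  by (rule Weierstrass_m_test_general[OF _ l1_le_summable[OF assms]]) (simp add: norm_mult)

lemma continuous_fourier_series:
  assumes "l1_le a A"
  shows "continuous_on UNIV (fourier_series a)"
  by (rule uniform_limit_theorem[OF _ fourier_series_uniform_limit[OF assms]])
     (auto intro!: always_eventually continuous_intros)

lemma measurable_fourier_series:
  assumes "l1_le a A"
  shows "fourier_series a \<in> borel_measurable borel"
  using continuous_fourier_series[OF assms] by (rule borel_measurable_continuous_onI)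

lemma fourier_series_bound:
  assumes "l1_le a A"
  shows "cmod (fourier_series a x) \<le> A"
proof -
  have s: "(\<lambda>k. cmod (a k * cis (freq k \<bullet> x))) summable_on UNIV"
    using l1_le_summable[OF assms] by (simp add: norm_mult)
  have "cmod (fourier_series a x) \<le> (\<Sum>\<^sub>\<infinity>k. cmod (a k * cis (freq k \<bullet> x)))"
    unfolding fourier_series_def by (rule norm_infsum_bound[OF s])
  then show ?thesis using l1_le_infsum[OF assms] by (simp add: norm_mult)
qed

lemma set_integrable_fourier_series:
  assumes "l1_le a A"
  shows "set_integrable lborel torus_cell (fourier_series a)"
  by (rule set_integrable_bounded_torus[OF measurable_fourier_series[OF assms] fourier_series_bound[OF assms]])

lemma periodic_fourier_series:
  fixes a :: "int ^ 'd \<Rightarrow> complex"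
  shows "periodic (fourier_series a)"
proof -
  have "cis (freq k \<bullet> (x + axis i (2 * pi))) = cis (freq k \<bullet> x)" for k :: "int ^ 'd" and x :: "real ^ 'd" and i
  proof -
    have "cis (freq k \<bullet> (x + axis i (2 * pi))) = cis (freq k \<bullet> x) * cis (2 * pi * real_of_int (k $ i))"
      by (simp add: inner_add_right inner_axis freq_def cis_mult mult.commute)
    then show ?thesis by (simp add: cis_multiple_2pi)
  qed
  then show ?thesis by (simp add: periodic_def fourier_series_def)
qed

lemma fourier_coeff_character:
  "fourier_coeff (\<lambda>x. cis (freq l \<bullet> x)) k = (if l = k then 1 else 0)"
proof -
  have "cis (freq l \<bullet> x) * cis (- (freq k \<bullet> x)) = cis (freq (l - k) \<bullet> x)" for x
    by (simp add: cis_mult freq_diff inner_diff_left)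
  then show ?thesis
    by (simp add: fourier_coeff_def integral_character)
qed

lemma fourier_coeff_trig_poly:
  assumes "finite G"
  shows "fourier_coeff (\<lambda>x. \<Sum>l\<in>G. a l * cis (freq l \<bullet> x)) k = (if k \<in> G then a k else 0)"
  using assms
proof (induction G rule: finite_induct)
  case empty
  then show ?case by (simp add: fourier_coeff_def)
next
  case (insert l G)
  have "set_integrable lborel torus_cell (\<lambda>x. \<Sum>l\<in>G. a l * cis (freq l \<bullet> x))"
    by (rule set_integrable_bounded_torus[where B="\<Sum>l\<in>G. cmod (a l)"])
       (auto intro!: sum_norm_le simp: norm_mult)
  moreover have "set_integrable lborel torus_cell (\<lambda>x. cis (freq l \<bullet> x))"
    by (rule set_integrable_bounded_torus[where B=1]) auto
  ultimately have "fourier_coeff (\<lambda>x. (\<Sum>l\<in>G. a l * cis (freq l \<bullet> x)) + a l * cis (freq l \<bullet> x)) k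
     = (if k \<in> G then a k else 0) + a l * (if l = k then 1 else 0)"
    by (subst fourier_coeff_add_scale) (simp_all add: insert.IH fourier_coeff_character)
  then show ?case using insert.hyps by (auto simp: add.commute)
qed

text \<open>The coefficient functional is bounded in the supremum norm and reproduces the coefficients of
trigonometric polynomials, which converge uniformly to the series.\<close>

lemma fourier_coeff_fourier_series:
  assumes "l1_le a A"
  shows "fourier_coeff (fourier_series a) = a"
proof
  fix k
  let ?P = "\<lambda>G x. \<Sum>l\<in>G. a l * cis (freq l \<bullet> x)"
  let ?F = "finite_subsets_at_top UNIV"
  have mP: "?P G \<in> borel_measurable borel" for G by measurable
  have iP: "set_integrable lborel torus_cell (?P G)" for G
    by (rule set_integrable_bounded_torus[where B="\<Sum>l\<in>G. cmod (a l)"])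
       (auto intro!: sum_norm_le simp: norm_mult)
  have "((\<lambda>G. fourier_coeff (?P G) k) \<longlongrightarrow> fourier_coeff (fourier_series a) k) ?F"
  proof (rule tendstoI)
    fix e :: real assume "e > 0"
    then have "\<forall>\<^sub>F G in ?F. \<forall>x\<in>UNIV. dist (?P G x) (fourier_series a x) < e / 2"
      by (intro uniform_limitD[OF fourier_series_uniform_limit[OF assms]]) auto
    then show "\<forall>\<^sub>F G in ?F. dist (fourier_coeff (?P G) k) (fourier_coeff (fourier_series a) k) < e"
    proof (rule eventually_mono)
      fix G assume G: "\<forall>x\<in>UNIV. dist (?P G x) (fourier_series a x) < e / 2"
      have "cmod (fourier_coeff (\<lambda>x. ?P G x - fourier_series a x) k) \<le> e / 2"
        by (rule fourier_coeff_bound)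
           (use G mP measurable_fourier_series[OF assms] in \<open>auto simp: dist_norm intro!: less_imp_le borel_measurable_diff\<close>)
      then show "dist (fourier_coeff (?P G) k) (fourier_coeff (fourier_series a) k) < e"
        using \<open>e > 0\<close> unfolding fourier_coeff_diff[OF iP set_integrable_fourier_series[OF assms]]
        by (simp add: dist_norm)
    qed
  qed
  moreover have "((\<lambda>G. fourier_coeff (?P G) k) \<longlongrightarrow> a k) ?F"
  proof (rule tendsto_eventually)
    show "\<forall>\<^sub>F G in ?F. fourier_coeff (?P G) k = a k"
      unfolding eventually_finite_subsets_at_top
      by (intro exI[of _ "{k}"]) (auto simp: fourier_coeff_trig_poly)
  qed
  ultimately show "fourier_coeff (fourier_series a) k = a k"
    by (rule tendsto_unique[rotated]) simp
qed

text \<open>The Cauchy product: the double series converges absolutely and may be summed along \<open>l + j = k\<close>.\<close>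

lemma fourier_series_mult:
  assumes a: "l1_le a A" and b: "l1_le b B"
  shows "fourier_series a x * fourier_series b x = fourier_series (conv a b) x"
proof -
  let ?a = "\<lambda>k. a k * cis (freq k \<bullet> x)" and ?b = "\<lambda>k. b k * cis (freq k \<bullet> x)"
  have sa: "(\<lambda>k. cmod (?a k)) summable_on UNIV" and sb: "(\<lambda>k. cmod (?b k)) summable_on UNIV"
    using l1_le_summable[OF a] l1_le_summable[OF b] by (auto simp: norm_mult)
  have s: "(\<lambda>(l, j). ?a l * ?b j) summable_on UNIV \<times> UNIV"
  proof (rule abs_summable_summable)
    have "(\<lambda>j. norm (?a l * ?b j)) summable_on UNIV" for l
      using summable_on_cmult_right[OF sb, of "cmod (?a l)"] by (simp add: norm_mult)
    moreover have "(\<lambda>l. norm (\<Sum>\<^sub>\<infinity>j. norm (?a l * ?b j))) summable_on UNIV"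
      using summable_on_cmult_left[OF sa, of "\<Sum>\<^sub>\<infinity>j. cmod (?b j)"]
      by (simp add: norm_mult infsum_cmult_right' abs_mult infsum_nonneg)
    ultimately show "(\<lambda>p. norm (case p of (l, j) \<Rightarrow> ?a l * ?b j)) summable_on UNIV \<times> UNIV"
      using Infinite_Sum.abs_summable_on_Sigma_iff[of "\<lambda>(l, j). ?a l * ?b j" UNIV "\<lambda>_. UNIV"] by simp
  qed
  have bij: "bij_betw (\<lambda>(k, l). (l, k - l)) (UNIV \<times> UNIV) (UNIV \<times> (UNIV :: (int ^ 'a) set))"
    by (rule bij_betw_byWitness[where f'="\<lambda>(l, j). (l + j, l)"]) auto
  have s': "(\<lambda>(k, l). ?a l * ?b (k - l)) summable_on UNIV \<times> UNIV"
    using s by (subst (asm) summable_on_reindex_bij_betw[OF bij, symmetric]) (simp add: case_prod_unfold)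
  have "fourier_series a x * fourier_series b x = (\<Sum>\<^sub>\<infinity>l. \<Sum>\<^sub>\<infinity>j. ?a l * ?b j)"
    by (simp only: fourier_series_def infsum_cmult_right' infsum_cmult_left')
  also have "\<dots> = (\<Sum>\<^sub>\<infinity>(l, j)\<in>UNIV \<times> UNIV. ?a l * ?b j)"
    using infsum_Sigma_banach[OF s] by simp
  also have "\<dots> = (\<Sum>\<^sub>\<infinity>(k, l)\<in>UNIV \<times> UNIV. ?a l * ?b (k - l))"
    by (subst infsum_reindex_bij_betw[OF bij, symmetric]) (simp add: case_prod_unfold)
  also have "\<dots> = (\<Sum>\<^sub>\<infinity>k. \<Sum>\<^sub>\<infinity>l. ?a l * ?b (k - l))"
    using infsum_Sigma_banach[OF s'] by simp
  also have "\<dots> = fourier_series (conv a b) x"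
    unfolding fourier_series_def conv_def infsum_cmult_left'[symmetric]
  proof (intro infsum_cong)
    fix k l :: "int ^ 'a"
    have "cis (freq l \<bullet> x) * cis (freq (k - l) \<bullet> x) = cis (freq k \<bullet> x)"
      by (simp add: cis_mult freq_diff inner_diff_left)
    then have "a l * b (k - l) * (cis (freq l \<bullet> x) * cis (freq (k - l) \<bullet> x)) = a l * b (k - l) * cis (freq k \<bullet> x)"
      by simp
    then show "?a l * ?b (k - l) = a l * b (k - l) * cis (freq k \<bullet> x)"
      by (simp only: mult_ac)
  qed
  finally show ?thesis .
qed

lemma fourier_series_unit_seq: "fourier_series unit_seq x = 1"
proof -
  have "fourier_series unit_seq x = (\<Sum>\<^sub>\<infinity>k\<in>{0}. unit_seq k * cis (freq k \<bullet> x))"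
    unfolding fourier_series_def by (rule infsum_cong_neutral) (auto simp: unit_seq_def)
  then show ?thesis by (simp add: unit_seq_def)
qed

lemma cnj_fourier_series: "cnj (fourier_series a x) = fourier_series (conj_seq a) x"
proof -
  have "cnj (fourier_series a x) = (\<Sum>\<^sub>\<infinity>k. cnj (a k * cis (freq k \<bullet> x)))"
    unfolding fourier_series_def by (rule infsum_cnj[symmetric])
  also have "\<dots> = (\<Sum>\<^sub>\<infinity>k. cnj (a (- k) * cis (freq (- k) \<bullet> x)))"
    by (subst infsum_reindex_bij_betw[OF bij_uminus, symmetric]) simp
  finally show ?thesis
    by (simp add: fourier_series_def conj_seq_def freq_minus cis_cnj)
qed

context sobolev_algebra
begin

lemma fourier_series_power:
  assumes "sobolev_le r (a :: int ^ 'd \<Rightarrow> complex) A"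
  shows "fourier_series a x ^ n = fourier_series (conv_pow a n) x"
proof (induction n)
  case 0
  show ?case by (simp add: fourier_series_unit_seq)
next
  case (Suc n)
  obtain B where B: "sobolev_le r (conv_pow a n) B" using conv_pow_bound[of A n] assms by blast
  show ?case
    using fourier_series_mult[OF l1_bound[OF assms] l1_bound[OF B], of x] by (simp add: Suc)
qed

lemma schroedinger_group_eq:
  "schroedinger_group t f = fourier_series (flow t (fourier_coeff f))"
  by (simp add: schroedinger_group_def laplace_fun_eq flow_def fun_eq_iff fourier_series_def cis_conv_exp mult_ac)

lemma phi1_op_eq: "phi1_op \<tau> f = fourier_series (\<lambda>k. phi_symbol \<tau> k * fourier_coeff f k)"
  by (simp add: phi1_op_def laplace_fun_eq fun_eq_iff fourier_series_def phi_symbol_def mult_ac)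

lemma schroedinger_group_fourier_series:
  assumes "sobolev_le r (a :: int ^ 'd \<Rightarrow> complex) A"
  shows "schroedinger_group t (fourier_series a) = fourier_series (flow t a)"
  by (simp add: schroedinger_group_eq fourier_coeff_fourier_series[OF l1_bound[OF assms]])

text \<open>Splitting the modulus as \<open>|z|\<^bsup>2p\<^esup> z = z\<^bsup>p+1\<^esup> (cnj z)\<^sup>p\<close> makes the nonlinearity a polynomial in \<open>z\<close> and \<open>cnj z\<close>,
hence an iterated convolution.\<close>

lemma twisted_nonlinearity_eq:
  fixes f :: "real ^ 'd \<Rightarrow> complex"
  assumes "sobolev_le r (fourier_coeff f) A"
  shows "twisted_nonlinearity p s f = fourier_series (twisted_product p s (\<lambda>_. 1) (fourier_coeff f))"
proof -
  let ?a = "fourier_coeff f"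
  let ?u = "flow s ?a" and ?v = "flow (- s) (conj_seq ?a)"
  have u: "sobolev_le r ?u A" and v: "sobolev_le r ?v A" using assms by (auto simp: sobolev_le_conj_seq)
  obtain B1 where B1: "sobolev_le r (conv_pow ?u (p + 1)) B1" using conv_pow_bound[of A "p + 1"] u by blast
  obtain B2 where B2: "sobolev_le r (conv_pow ?v p) B2" using conv_pow_bound[of A p] v by blast
  have *: "of_real (cmod z ^ (2 * p)) * z = z ^ (p + 1) * cnj z ^ p" for z
  proof -
    have "of_real (cmod z ^ (2 * p)) = (z * cnj z) ^ p"
      by (simp add: power_mult complex_norm_square[symmetric])
    then show ?thesis by (simp add: power_mult_distrib mult_ac)
  qed
  have "twisted_nonlinearity p s f
     = schroedinger_group (- s) (\<lambda>y. fourier_series ?u y ^ (p + 1) * cnj (fourier_series ?u y) ^ p)"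
    unfolding twisted_nonlinearity_def * schroedinger_group_eq[of s] ..
  also have "(\<lambda>y. fourier_series ?u y ^ (p + 1) * cnj (fourier_series ?u y) ^ p)
     = fourier_series (conv (conv_pow ?u (p + 1)) (conv_pow ?v p))"
    unfolding cnj_fourier_series conj_seq_flow fourier_series_power[OF u] fourier_series_power[OF v]
      fourier_series_mult[OF l1_bound[OF B1] l1_bound[OF B2]] ..
  also have "schroedinger_group (- s) \<dots> = fourier_series (flow (- s) (conv (conv_pow ?u (p + 1)) (conv_pow ?v p)))"
    by (rule schroedinger_group_fourier_series[OF conv_bound[OF B1 B2]])
  finally show ?thesis by (simp add: twisted_product_def)
qed

lemma scheme_increment_eq:
  fixes w :: "real ^ 'd \<Rightarrow> complex"
  assumes "sobolev_le r (fourier_coeff w) A"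
  shows "schroedinger_group (- t) (\<lambda>y. schroedinger_group t w y ^ (p + 1) *
           phi1_op \<tau> (\<lambda>z. schroedinger_group (- t) (\<lambda>u. cnj (w u)) z ^ p) y)
      = fourier_series (twisted_product p t (phi_symbol \<tau>) (fourier_coeff w))"
proof -
  let ?a = "fourier_coeff w"
  let ?u = "flow t ?a" and ?v = "flow (- t) (conj_seq ?a)"
  have u: "sobolev_le r ?u A" and v: "sobolev_le r ?v A" using assms by (auto simp: sobolev_le_conj_seq)
  obtain B1 where B1: "sobolev_le r (conv_pow ?u (p + 1)) B1" using conv_pow_bound[of A "p + 1"] u by blast
  obtain B2 where B2: "sobolev_le r (conv_pow ?v p) B2" using conv_pow_bound[of A p] v by blast
  let ?Q = "\<lambda>k. phi_symbol \<tau> k * conv_pow ?v p k"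
  have Q: "sobolev_le r ?Q B2" by (rule sobolev_le_multiplier[OF B2 norm_phi_symbol])
  have "(\<lambda>z. schroedinger_group (- t) (\<lambda>u. cnj (w u)) z ^ p) = fourier_series (conv_pow ?v p)"
    unfolding schroedinger_group_eq fourier_coeff_cnj fourier_series_power[OF v] ..
  then have "phi1_op \<tau> (\<lambda>z. schroedinger_group (- t) (\<lambda>u. cnj (w u)) z ^ p) = fourier_series ?Q"
    by (simp add: phi1_op_eq fourier_coeff_fourier_series[OF l1_bound[OF B2]])
  moreover have "(\<lambda>y. schroedinger_group t w y ^ (p + 1)) = fourier_series (conv_pow ?u (p + 1))"
    unfolding schroedinger_group_eq fourier_series_power[OF u] ..
  ultimately have "(\<lambda>y. schroedinger_group t w y ^ (p + 1) *
           phi1_op \<tau> (\<lambda>z. schroedinger_group (- t) (\<lambda>u. cnj (w u)) z ^ p) y)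
      = fourier_series (conv (conv_pow ?u (p + 1)) ?Q)"
    unfolding fun_eq_iff fourier_series_mult[OF l1_bound[OF B1] l1_bound[OF Q], symmetric] by metis
  then show ?thesis
    unfolding twisted_product_def using schroedinger_group_fourier_series[OF conv_bound[OF B1 Q]] by simp
qed

end

section \<open>From mild solutions to equations for the Fourier coefficients\<close>

text \<open>Rounding \<open>x\<close> down to the lattice of width \<open>1/(n+1)\<close> gives functions that are jointly measurable, because only
countably many values of \<open>x\<close> occur; continuity in \<open>x\<close> recovers \<open>h\<close> in the limit.\<close>

lemma caratheodory_measurable:
  fixes h :: "'s \<Rightarrow> real ^ 'd \<Rightarrow> complex"
  assumes meas: "\<And>x. (\<lambda>s. h s x) \<in> borel_measurable M" and cont: "\<And>s. continuous_on UNIV (h s)"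
  shows "(\<lambda>(s, x). h s x) \<in> borel_measurable (M \<Otimes>\<^sub>M borel)"
proof -
  define z :: "nat \<Rightarrow> real ^ 'd \<Rightarrow> int ^ 'd" where "z = (\<lambda>n x. \<chi> i. \<lfloor>real (Suc n) * x $ i\<rfloor>)"
  define q :: "nat \<Rightarrow> int ^ 'd \<Rightarrow> real ^ 'd" where "q = (\<lambda>n k. inverse (real (Suc n)) *\<^sub>R freq k)"
  have nth [measurable]: "(\<lambda>x :: real ^ 'd. x $ i) \<in> borel_measurable borel" for i
    by (intro borel_measurable_continuous_onI continuous_intros)
  have z [measurable]: "z n \<in> measurable borel (count_space UNIV)" for n
  proof (subst measurable_count_space_eq2_countable, safe)
    fix k
    have "z n -` {k} \<inter> space borel = {x \<in> space borel. \<forall>i. \<lfloor>real (Suc n) * x $ i\<rfloor> = k $ i}"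
      by (auto simp: z_def vec_eq_iff)
    also have "\<dots> \<in> sets borel" by measurable
    finally show "z n -` {k} \<inter> space borel \<in> sets borel" .
  qed auto
  have lim: "(\<lambda>n. q n (z n x)) \<longlonglongrightarrow> x" for x
  proof (rule vec_tendstoI)
    fix i
    have 1: "(\<lambda>n. inverse (real (Suc n))) \<longlonglongrightarrow> 0" by (rule LIMSEQ_inverse_real_of_nat)
    have "(\<lambda>n. q n (z n x) $ i - x $ i) \<longlonglongrightarrow> 0"
    proof (rule Lim_null_comparison[OF _ 1], rule always_eventually, rule allI)
      fix n
      have "q n (z n x) $ i - x $ i = inverse (real (Suc n)) * (real_of_int \<lfloor>real (Suc n) * x $ i\<rfloor> - real (Suc n) * x $ i)"
        by (simp add: q_def z_def freq_def right_diff_distrib)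
      also have "\<bar>\<dots>\<bar> = inverse (real (Suc n)) * \<bar>real_of_int \<lfloor>real (Suc n) * x $ i\<rfloor> - real (Suc n) * x $ i\<bar>"
        by (simp add: abs_mult)
      also have "\<dots> \<le> inverse (real (Suc n)) * 1"
        by (rule mult_left_mono) (linarith, simp)
      finally show "norm (q n (z n x) $ i - x $ i) \<le> inverse (real (Suc n))" by simp
    qed
    then show "(\<lambda>n. q n (z n x) $ i) \<longlonglongrightarrow> x $ i"
      using LIM_zero_iff by blast
  qed
  show ?thesis
  proof (rule borel_measurable_LIMSEQ_metric)
    fix n
    show "(\<lambda>p. h (fst p) (q n (z n (snd p)))) \<in> borel_measurable (M \<Otimes>\<^sub>M borel)"
    proof (rule measurable_compose_countable[where f="\<lambda>k p. h (fst p) (q n k)"])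
      show "(\<lambda>p. h (fst p) (q n k)) \<in> borel_measurable (M \<Otimes>\<^sub>M borel)" for k
        using meas[of "q n k"] by measurable
    qed measurable
  next
    fix p :: "'s \<times> (real ^ 'd)"
    have "isCont (h (fst p)) (snd p)"
      using cont[of "fst p"] by (simp add: continuous_on_eq_continuous_at)
    then show "(\<lambda>n. h (fst p) (q n (z n (snd p)))) \<longlonglongrightarrow> (case p of (s, x) \<Rightarrow> h s x)"
      using isCont_tendsto_compose[OF _ lim] by (simp add: case_prod_unfold)
  qed
qed

text \<open>A null set contains no ball.\<close>

lemma AE_lborel_dense:
  fixes x :: "'a::euclidean_space"
  assumes "AE x in lborel. P x" "e > 0"
  shows "\<exists>y. dist y x < e \<and> P y"
proof (rule ccontr)
  assume *: "\<not> ?thesis"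
  obtain N where N: "{x \<in> space lborel. \<not> P x} \<subseteq> N" "N \<in> null_sets lborel"
    using assms(1) by (auto simp: eventually_ae_filter)
  have "ball x e \<subseteq> N" using * N(1) by (auto simp: dist_commute)
  moreover have "negligible N"
    using N(2) by (simp add: negligible_iff_null_sets null_sets_completionI)
  ultimately have "negligible (ball x e)" using negligible_subset by blast
  then show False using open_not_negligible[of "ball x e"] assms(2) by auto
qed

lemma torus_L2_set_integrable:
  assumes "f \<in> torus_L2"
  shows "set_integrable lborel torus_cell f"
  unfolding set_integrable_def
proof (rule Bochner_Integration.integrable_bound)
  have m [measurable]: "f \<in> borel_measurable borel" using assms by (simp add: torus_L2_def)
  have "set_integrable lborel torus_cell (\<lambda>x. 1 + (cmod (f x))\<^sup>2)"
  proof (rule set_integral_add)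
    show "set_integrable lborel torus_cell (\<lambda>x :: real ^ 'a. 1 :: real)"
      unfolding set_integrable_def using emeasure_torus_cell_finite by (intro integrable_scaleR_left) auto
  qed (use assms in \<open>simp add: torus_L2_def\<close>)
  then show "integrable lborel (\<lambda>x. indicator torus_cell x *\<^sub>R (1 + (cmod (f x))\<^sup>2))"
    by (simp add: set_integrable_def)
  show "(\<lambda>x. indicator torus_cell x *\<^sub>R f x) \<in> borel_measurable lborel" by measurable
  have "c \<le> 1 + c\<^sup>2" for c :: real
    using sum_squares_bound[of c 1] by (sos)
  then show "AE x in lborel. norm (indicator torus_cell x *\<^sub>R f x) \<le> norm (indicator torus_cell x *\<^sub>R (1 + (cmod (f x))\<^sup>2))"
    by (auto simp: indicator_def)
qed

lemma torus_L2_add_scale: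
  assumes f: "f \<in> torus_L2" and g: "periodic g" "g \<in> borel_measurable borel" "\<And>x. cmod (g x) \<le> B"
  shows "(\<lambda>x. f x + c * g x) \<in> torus_L2"
proof -
  have [measurable]: "f \<in> borel_measurable borel" "g \<in> borel_measurable borel"
    using f g by (auto simp: torus_L2_def)
  have "set_integrable lborel torus_cell (\<lambda>x. (cmod (f x + c * g x))\<^sup>2)"
    unfolding set_integrable_def
  proof (rule Bochner_Integration.integrable_bound)
    have "set_integrable lborel torus_cell (\<lambda>x. 2 * (cmod (f x))\<^sup>2 + 2 * (cmod c * B)\<^sup>2)"
    proof (rule set_integral_add)
      show "set_integrable lborel torus_cell (\<lambda>x :: real ^ 'a. 2 * (cmod c * B)\<^sup>2)"
        unfolding set_integrable_def using emeasure_torus_cell_finite by (intro integrable_scaleR_left) auto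
      show "set_integrable lborel torus_cell (\<lambda>x. 2 * (cmod (f x))\<^sup>2)"
        using f by (simp add: torus_L2_def)
    qed
    then show "integrable lborel (\<lambda>x. indicator torus_cell x *\<^sub>R (2 * (cmod (f x))\<^sup>2 + 2 * (cmod c * B)\<^sup>2))"
      by (simp add: set_integrable_def)
    have "(cmod (f x + c * g x))\<^sup>2 \<le> 2 * (cmod (f x))\<^sup>2 + 2 * (cmod c * B)\<^sup>2" for x
    proof -
      have "cmod (f x + c * g x) \<le> cmod (f x) + cmod c * B"
        using norm_triangle_ineq[of "f x" "c * g x"] mult_left_mono[OF g(3)[of x] norm_ge_zero[of c]]
        by (simp add: norm_mult)
      then have "(cmod (f x + c * g x))\<^sup>2 \<le> (cmod (f x) + cmod c * B)\<^sup>2"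
        by (intro power_mono) auto
      also have "\<dots> \<le> 2 * (cmod (f x))\<^sup>2 + 2 * (cmod c * B)\<^sup>2"
        using sum_squares_bound[of "cmod (f x)" "cmod c * B"] by (simp add: power2_sum)
      finally show ?thesis .
    qed
    then show "AE x in lborel. norm (indicator torus_cell x *\<^sub>R (cmod (f x + c * g x))\<^sup>2)
        \<le> norm (indicator torus_cell x *\<^sub>R (2 * (cmod (f x))\<^sup>2 + 2 * (cmod c * B)\<^sup>2))"
      by (auto simp: indicator_def)
  qed measurable
  moreover have "periodic (\<lambda>x. f x + c * g x)"
    using f g by (simp add: torus_L2_def periodic_def)
  ultimately show ?thesis by (simp add: torus_L2_def)
qed

lemma torus_L2_fourier_coeff_diff: "f \<in> torus_L2 \<Longrightarrow> g \<in> torus_L2 \<Longrightarrow>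
   fourier_coeff (\<lambda>x. f x - g x) = (\<lambda>k. fourier_coeff f k - fourier_coeff g k)"
  by (rule ext, rule fourier_coeff_diff) (rule torus_L2_set_integrable, assumption)+

lemma weight_square: "weight (2 * r) k * (cmod z)\<^sup>2 = (weight r k * cmod z)\<^sup>2"
proof -
  have "weight (2 * r) k = weight r k * weight r k"
    unfolding mult_2 by (rule weight_mult)
  then show ?thesis by (simp add: power2_eq_square)
qed

lemma sobolev_norm_weight:
  "sobolev_norm r f = sqrt (\<Sum>\<^sub>\<infinity>k. (weight r k * cmod (fourier_coeff f k))\<^sup>2)"
  by (simp add: sobolev_norm_def flip: weight_def weight_square)

lemma sobolev_space_weight:
  "f \<in> sobolev_space r \<longleftrightarrow> f \<in> torus_L2 \<and>
     (\<lambda>k. (weight r k * cmod (fourier_coeff f k))\<^sup>2) summable_on UNIV"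
  by (simp add: sobolev_space_def flip: weight_def weight_square)

lemma sobolev_le_sobolev_norm:
  assumes "f \<in> sobolev_space r"
  shows "sobolev_le r (fourier_coeff f) (sobolev_norm r f)"
  unfolding sobolev_le_def L2_set_def sobolev_norm_weight
  using assms by (auto intro!: real_sqrt_le_mono finite_sum_le_infsum simp: sobolev_space_weight)

lemma sobolev_le_sum_squares:
  assumes "sobolev_le r a M" "finite F"
  shows "(\<Sum>k\<in>F. (weight r k * cmod (a k))\<^sup>2) \<le> M\<^sup>2"
  using sobolev_leD[OF assms] sobolev_le_nonneg[OF assms(1)] by (simp add: L2_set_def real_sqrt_le_iff real_le_lsqrt sqrt_le_D)

lemma sobolev_le_imp_sobolev_space:
  assumes "f \<in> torus_L2" "sobolev_le r (fourier_coeff f) M"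
  shows "f \<in> sobolev_space r"
  unfolding sobolev_space_weight
  using assms(1) sobolev_le_sum_squares[OF assms(2)]
  by (auto intro!: nonneg_bdd_above_summable_on bdd_aboveI)

lemma sobolev_le_imp_sobolev_norm_le:
  assumes "sobolev_le r (fourier_coeff f) M"
  shows "sobolev_norm r f \<le> M"
proof -
  have "(\<Sum>\<^sub>\<infinity>k. (weight r k * cmod (fourier_coeff f k))\<^sup>2) \<le> M\<^sup>2"
    using sobolev_le_sum_squares[OF assms]
    by (intro infsum_le_finite_sums nonneg_bdd_above_summable_on) (auto intro!: bdd_aboveI)
  then show ?thesis
    unfolding sobolev_norm_weight using sobolev_le_nonneg[OF assms] real_le_lsqrt by (simp add: real_le_lsqrt infsum_nonneg)
qed

text \<open>Testing the mild equation with a character requires exchanging the integrals over time and space.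
The integrand is a continuous function of \<open>x\<close> for each time, uniformly bounded by the embedding into
absolutely convergent series. The definition of a mild solution provides measurability in time for almost
every \<open>x\<close>; by density and continuity in \<open>x\<close> it holds for every \<open>x\<close>, so the integrand is jointly measurable and
Fubini's theorem applies.\<close>

lemma (in sobolev_algebra) mild_solution_duhamel:
  fixes v :: "real \<Rightarrow> real ^ 'd \<Rightarrow> complex"
  assumes mild: "mild_solution p \<mu> T v" and "T > 0"
    and L2: "\<And>t. t \<in> {0..T} \<Longrightarrow> v t \<in> torus_L2"
    and M: "\<And>t. t \<in> {0..T} \<Longrightarrow> sobolev_le r (fourier_coeff (v t)) M"
  shows "duhamel_solution p \<mu> T (\<lambda>t. fourier_coeff (v t))"
proof -
  define N where "N = (\<lambda>s. twisted_product p s (\<lambda>_. 1) (fourier_coeff (v s)))"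
  obtain B where "\<And>s. s \<in> {0..T} \<Longrightarrow> sobolev_le r (N s) B"
    using twisted_product_bound[of M p] M unfolding N_def by (metis norm_one order_refl)
  then have Nl1: "\<And>s. s \<in> {0..T} \<Longrightarrow> l1_le (N s) (K * B)" by (rule l1_bound)
  \<comment> \<open>Extending by zero outside the time interval makes continuity in x and boundedness hold for all times.\<close>
  define h where "h = (\<lambda>s x. if s \<in> {0..T} then fourier_series (N s) x else 0)"
  have KB: "0 \<le> K * B" using Nl1[of 0] \<open>T > 0\<close> unfolding l1_le_def by force
  have h_bound: "cmod (h s x) \<le> K * B" for s x
    using fourier_series_bound[OF Nl1] KB by (simp add: h_def)
  have h_cont: "continuous_on UNIV (h s)" for s
    using continuous_fourier_series[OF Nl1] by (cases "s \<in> {0..T}") (auto simp: h_def[abs_def])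
  have h_eq: "twisted_nonlinearity p s (v s) x = h s x" if "s \<in> {0..T}" for s x
    using twisted_nonlinearity_eq[OF M[OF that]] that by (simp add: h_def N_def)
  have h_meas1: "(\<lambda>s. h s x) \<in> borel_measurable borel" for x
  proof -
    have ae: "AE x in lborel. (\<lambda>s. h s x) \<in> borel_measurable borel"
    proof -
      have "AE x in lborel. set_integrable lborel {0..T} (\<lambda>s. twisted_nonlinearity p s (v s) x)"
        using mild \<open>T > 0\<close> unfolding mild_solution_def by (auto elim: AE_mp)
      then show ?thesis
      proof (rule AE_mp, intro AE_I2 impI)
        fix x assume "set_integrable lborel {0..T} (\<lambda>s. twisted_nonlinearity p s (v s) x)"
        then have "(\<lambda>s. indicator {0..T} s *\<^sub>R twisted_nonlinearity p s (v s) x) \<in> borel_measurable lborel"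
          unfolding set_integrable_def by (rule borel_measurable_integrable)
        also have "(\<lambda>s. indicator {0..T} s *\<^sub>R twisted_nonlinearity p s (v s) x) = (\<lambda>s. h s x)"
          using h_eq by (auto simp: fun_eq_iff indicator_def h_def)
        finally show "(\<lambda>s. h s x) \<in> borel_measurable borel" by simp
      qed
    qed
    have "\<exists>y. \<forall>n. dist (y n) x < inverse (real (Suc n)) \<and> (\<lambda>s. h s (y n)) \<in> borel_measurable borel"
      by (intro choice allI AE_lborel_dense[OF ae]) simp
    then obtain y where y: "\<And>n. dist (y n) x < inverse (real (Suc n))"
      "\<And>n. (\<lambda>s. h s (y n)) \<in> borel_measurable borel" by blast
    have lim: "y \<longlonglongrightarrow> x"
      by (subst tendsto_dist_iff, rule Lim_null_comparison[OF _ LIMSEQ_inverse_real_of_nat])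
         (use y(1) in \<open>auto intro!: always_eventually less_imp_le\<close>)
    show ?thesis
    proof (rule borel_measurable_LIMSEQ_metric[OF y(2)])
      fix s
      have "isCont (h s) x" using h_cont[of s] by (simp add: continuous_on_eq_continuous_at)
      then show "(\<lambda>n. h s (y n)) \<longlonglongrightarrow> h s x" by (rule isCont_tendsto_compose[OF _ lim])
    qed
  qed
  have h_meas [measurable]: "(\<lambda>(s, x). h s x) \<in> borel_measurable (borel \<Otimes>\<^sub>M borel)"
    by (rule caratheodory_measurable[OF h_meas1 h_cont])
  define J where "J = (\<lambda>t x. \<integral>s. indicator {0..t} s *\<^sub>R h s x \<partial>lborel)"
  have J_meas [measurable]: "J t \<in> borel_measurable borel" for t
    unfolding J_def by measurable
  have J_bound: "cmod (J t x) \<le> t * (K * B)" if "t \<ge> 0" for t x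
  proof -
    have i: "integrable lborel (\<lambda>s. indicator {0..t} s *\<^sub>R h s x)"
      by (rule integrableI_bounded_set_indicator[where B="K * B"]) (use h_meas1 h_bound emeasure_lborel_cbox_finite[of 0 t] in \<open>auto simp: less_top\<close>)
    have i': "integrable lborel (\<lambda>s. indicator {0..t} s *\<^sub>R (K * B))"
      by (rule integrableI_bounded_set_indicator[where B="\<bar>K * B\<bar>"])
         (use emeasure_lborel_cbox_finite[of 0 t] in \<open>auto simp: less_top\<close>)
    have "cmod (J t x) \<le> (\<integral>s. norm (indicator {0..t} s *\<^sub>R h s x) \<partial>lborel)"
      unfolding J_def by (rule integral_norm_bound)
    also have "\<dots> \<le> (\<integral>s. indicator {0..t} s *\<^sub>R (K * B) \<partial>lborel)"
      by (rule integral_mono[OF integrable_norm[OF i] i']) (use h_bound KB in \<open>auto simp: indicator_def\<close>)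
    finally show ?thesis using that by simp
  qed
  have J_coeff: "fourier_coeff (J t) k = (\<integral>s. indicator {0..t} s *\<^sub>R N s k \<partial>lborel)"
    and N_int: "integrable lborel (\<lambda>s. indicator {0..t} s *\<^sub>R N s k)" if t: "t \<in> {0..T}" for t k
  proof -
    define F where "F = (\<lambda>s x. indicator ({0..t} \<times> torus_cell) (s, x) *\<^sub>R (h s x * cis (- (freq k \<bullet> x))))"
    have F: "integrable (lborel \<Otimes>\<^sub>M lborel) (case_prod F)"
    proof -
      have "integrable (lborel \<Otimes>\<^sub>M lborel) (\<lambda>z. indicator ({0..t} \<times> torus_cell) z *\<^sub>R
          (case z of (s, x) \<Rightarrow> h s x * cis (- (freq k \<bullet> x))))"
      proof (rule integrableI_bounded_set_indicator[where B="K * B"])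
        show "emeasure (lborel \<Otimes>\<^sub>M lborel) ({0..t} \<times> (torus_cell :: (real ^ 'd) set)) < \<infinity>"
          using emeasure_torus_cell_finite[where 'a='d] emeasure_lborel_cbox_finite[of 0 t]
          by (subst lborel.emeasure_pair_measure_Times) (auto simp: ennreal_mult_less_top)
        show "(\<lambda>(s, x). h s x * cis (- (freq k \<bullet> x))) \<in> borel_measurable (lborel \<Otimes>\<^sub>M lborel)"
          by measurable
      qed (use h_bound in \<open>auto simp: norm_mult\<close>)
      then show ?thesis by (simp add: F_def case_prod_unfold)
    qed
    have 1: "(\<integral>s. F s x \<partial>lborel) = indicator torus_cell x *\<^sub>R (J t x * cis (- (freq k \<bullet> x)))" for x
    proof -
      have "(\<integral>s. F s x \<partial>lborel) = (\<integral>s. (indicator {0..t} s *\<^sub>R h s x) * (indicator torus_cell x *\<^sub>R cis (- (freq k \<bullet> x))) \<partial>lborel)"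
        by (intro Bochner_Integration.integral_cong) (auto simp: F_def indicator_def)
      also have "\<dots> = J t x * (indicator torus_cell x *\<^sub>R cis (- (freq k \<bullet> x)))"
        unfolding J_def by (rule integral_mult_left_zero)
      finally show ?thesis by simp
    qed
    have 2: "(\<integral>x. F s x \<partial>lborel) = of_real ((2 * pi) ^ CARD('d)) * (indicator {0..t} s *\<^sub>R N s k)" for s
    proof (cases "s \<in> {0..t}")
      case True
      then have s: "s \<in> {0..T}" using t by auto
      have "(\<integral>x. F s x \<partial>lborel) = (LINT x:torus_cell|lborel. fourier_series (N s) x * cis (- (freq k \<bullet> x)))"
        unfolding set_lebesgue_integral_def using True s
        by (intro Bochner_Integration.integral_cong) (auto simp: F_def indicator_def h_def)
      also have "\<dots> = of_real ((2 * pi) ^ CARD('d)) * fourier_coeff (fourier_series (N s)) k"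
        by (simp add: fourier_coeff_def)
      finally show ?thesis using True by (simp add: fourier_coeff_fourier_series[OF Nl1[OF s]])
    qed (simp add: F_def indicator_times)
    have "fourier_coeff (J t) k = (\<integral>x. \<integral>s. F s x \<partial>lborel \<partial>lborel) / of_real ((2 * pi) ^ CARD('d))"
      by (simp add: fourier_coeff_def set_lebesgue_integral_def 1)
    also have "(\<integral>x. \<integral>s. F s x \<partial>lborel \<partial>lborel) = (\<integral>s. \<integral>x. F s x \<partial>lborel \<partial>lborel)"
      by (rule lborel_pair.Fubini_integral[OF F])
    also have "\<dots> = of_real ((2 * pi) ^ CARD('d)) * (\<integral>s. indicator {0..t} s *\<^sub>R N s k \<partial>lborel)"
      unfolding 2 by (rule integral_mult_right_zero)
    finally show "fourier_coeff (J t) k = (\<integral>s. indicator {0..t} s *\<^sub>R N s k \<partial>lborel)" by simp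
    have "integrable lborel (\<lambda>s. \<integral>x. F s x \<partial>lborel)"
      using lborel_pair.integrable_fst[OF F] by simp
    then have "integrable lborel (\<lambda>s. inverse (of_real ((2 * pi) ^ CARD('d))) * (\<integral>x. F s x \<partial>lborel))"
      by (rule integrable_mult_right)
    also have "(\<lambda>s. inverse (of_real ((2 * pi) ^ CARD('d))) * (\<integral>x. F s x \<partial>lborel))
        = (\<lambda>s. indicator {0..t} s *\<^sub>R N s k)"
      unfolding 2 mult.assoc[symmetric] by (subst left_inverse) simp_all
    finally show "integrable lborel (\<lambda>s. indicator {0..t} s *\<^sub>R N s k)" .
  qed
  have coeff: "fourier_coeff (v t) k = fourier_coeff (v 0) k - \<i> * of_real \<mu> * integral {0..t} (\<lambda>s. N s k)"
    and N_on: "(\<lambda>s. N s k) integrable_on {0..t}" if t: "t \<in> {0..T}" for t k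
  proof -
    have si: "set_integrable lborel {0..t} (\<lambda>s. N s k)"
      using N_int[OF t] by (simp add: set_integrable_def)
    then show "(\<lambda>s. N s k) integrable_on {0..t}" by (rule set_borel_integral_eq_integral)
    have v0: "v 0 \<in> torus_L2" using L2[of 0] \<open>T > 0\<close> by auto
    have [measurable]: "v t \<in> borel_measurable borel" "v 0 \<in> borel_measurable borel"
      using L2[OF t] v0 by (auto simp: torus_L2_def)
    have ae: "AE x in lborel. v t x = v 0 x + - (\<i> * of_real \<mu>) * J t x"
    proof -
      have "AE x in lborel. v t x = v 0 x - \<i> * of_real \<mu> * (LINT s:{0..t}|lborel. twisted_nonlinearity p s (v s) x)"
        using mild t unfolding mild_solution_def by (auto elim: AE_mp)
      moreover have "(LINT s:{0..t}|lborel. twisted_nonlinearity p s (v s) x) = J t x" for x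
        unfolding J_def set_lebesgue_integral_def
        by (intro Bochner_Integration.integral_cong) (use t h_eq in \<open>auto simp: indicator_def\<close>)
      ultimately show ?thesis by simp
    qed
    have "fourier_coeff (v t) k = fourier_coeff (\<lambda>x. v 0 x + - (\<i> * of_real \<mu>) * J t x) k"
    proof -
      have "(\<integral>x. indicator torus_cell x *\<^sub>R (v t x * cis (- (freq k \<bullet> x))) \<partial>lborel)
          = (\<integral>x. indicator torus_cell x *\<^sub>R
               ((v 0 x + - (\<i> * of_real \<mu>) * J t x) * cis (- (freq k \<bullet> x))) \<partial>lborel)"
      proof (rule integral_cong_AE)
        show "AE x in lborel. indicator torus_cell x *\<^sub>R (v t x * cis (- (freq k \<bullet> x)))
          = indicator torus_cell x *\<^sub>R ((v 0 x + - (\<i> * of_real \<mu>) * J t x) * cis (- (freq k \<bullet> x)))"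
          using ae by eventually_elim (simp only:)
      qed measurable
      then show ?thesis by (simp only: fourier_coeff_def set_lebesgue_integral_def)
    qed
    also have "\<dots> = fourier_coeff (v 0) k + - (\<i> * of_real \<mu>) * fourier_coeff (J t) k"
      by (rule fourier_coeff_add_scale[OF torus_L2_set_integrable[OF v0] set_integrable_bounded_torus[OF J_meas J_bound]])
         (use t in auto)
    also have "fourier_coeff (J t) k = integral {0..t} (\<lambda>s. N s k)"
      using J_coeff[OF t] set_borel_integral_eq_integral(2)[OF si] by (simp add: set_lebesgue_integral_def)
    finally show "fourier_coeff (v t) k = fourier_coeff (v 0) k - \<i> * of_real \<mu> * integral {0..t} (\<lambda>s. N s k)"
      by simp
  qed
  show ?thesis
    unfolding duhamel_solution_def
  proof (intro allI impI, elim conjE)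
    fix k t1 t2 assume t: "0 \<le> t1" "t1 \<le> t2" "t2 \<le> T"
    have T: "t1 \<in> {0..T}" "t2 \<in> {0..T}" using t by auto
    have "(\<lambda>s. N s k) integrable_on {t1..t2}"
      by (rule integrable_subinterval_real[OF N_on[OF T(2)]]) (use t in auto)
    then have "((\<lambda>s. - (\<i> * of_real \<mu>) * N s k) has_integral - (\<i> * of_real \<mu>) * integral {t1..t2} (\<lambda>s. N s k)) {t1..t2}"
      by (intro has_integral_mult_right integrable_integral)
    moreover have comb: "integral {0..t1} (\<lambda>s. N s k) + integral {t1..t2} (\<lambda>s. N s k) = integral {0..t2} (\<lambda>s. N s k)"
      by (rule Henstock_Kurzweil_Integration.integral_combine[OF t(1,2) N_on[OF T(2)]])
    have "- (\<i> * of_real \<mu>) * integral {t1..t2} (\<lambda>s. N s k) = fourier_coeff (v t2) k - fourier_coeff (v t1) k"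
    proof -
      have "- m * y = (a - m * (x + y)) - (a - m * x)" for a m x y :: complex
        by (simp add: algebra_simps)
      then show ?thesis unfolding coeff[OF T(1)] coeff[OF T(2)] comb[symmetric] by blast
    qed
    ultimately have "((\<lambda>s. - (\<i> * of_real \<mu> * N s k)) has_integral fourier_coeff (v t2) k - fourier_coeff (v t1) k) {t1..t2}"
      by (simp only: minus_mult_left)
    then show "((\<lambda>s. - (\<i> * of_real \<mu> * twisted_product p s (\<lambda>_. 1) (fourier_coeff (v s)) k)) has_integral
        fourier_coeff (v t2) k - fourier_coeff (v t1) k) {t1..t2}"
      by (simp only: N_def)
  qed
qed

section \<open>The scheme and the convergence theorem\<close>

text \<open>The first iterate is merely an \<open>L\<^sup>2\<close> representative, to which every time level adds an absolutely
convergent Fourier series; therefore all iterates are square integrable and their coefficients obey the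
recursion of \<open>scheme_seq\<close>.\<close>

lemma (in sobolev_algebra) low_reg_scheme_coeff:
  fixes v0 :: "real ^ 'd \<Rightarrow> complex"
  assumes "v0 \<in> torus_L2" "sobolev_le r (fourier_coeff v0) A"
  shows "low_reg_scheme p \<mu> \<tau> v0 n \<in> torus_L2 \<and>
     fourier_coeff (low_reg_scheme p \<mu> \<tau> v0 n) = scheme_seq p \<mu> \<tau> (fourier_coeff v0) n \<and>
     (\<exists>A. sobolev_le r (scheme_seq p \<mu> \<tau> (fourier_coeff v0) n) A)"
proof (induction n)
  case 0
  then show ?case using assms by auto
next
  case (Suc n)
  let ?w = "low_reg_scheme p \<mu> \<tau> v0 n" and ?t = "real n * \<tau>"
  obtain A where w: "sobolev_le r (fourier_coeff ?w) A" using Suc.IH by auto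
  let ?N = "twisted_product p ?t (phi_symbol \<tau>) (fourier_coeff ?w)"
  let ?c = "- (\<i> * of_real \<mu> * of_real \<tau>)"
  obtain B where N: "sobolev_le r ?N B"
    using twisted_product_bound[of A p] w norm_phi_symbol by blast
  note l1 = l1_bound[OF N]
  have eq: "low_reg_scheme p \<mu> \<tau> v0 (Suc n) = (\<lambda>x. ?w x + ?c * fourier_series ?N x)"
    by (simp only: low_reg_scheme.simps Let_def scheme_increment_eq[OF w]) simp
  have L2: "?w \<in> torus_L2" using Suc.IH by auto
  have "low_reg_scheme p \<mu> \<tau> v0 (Suc n) \<in> torus_L2"
    unfolding eq
    by (rule torus_L2_add_scale[OF L2 periodic_fourier_series measurable_fourier_series[OF l1] fourier_series_bound[OF l1]])
  moreover have coeff: "fourier_coeff (low_reg_scheme p \<mu> \<tau> v0 (Suc n)) = (\<lambda>k. fourier_coeff ?w k + ?c * ?N k)"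
    unfolding eq
    by (rule ext) (simp only: fourier_coeff_add_scale[OF torus_L2_set_integrable[OF L2] set_integrable_fourier_series[OF l1]]
        fourier_coeff_fourier_series[OF l1])
  moreover have "(\<lambda>k. fourier_coeff ?w k + ?c * ?N k) = scheme_seq p \<mu> \<tau> (fourier_coeff v0) (Suc n)"
  proof -
    have "fourier_coeff ?w = scheme_seq p \<mu> \<tau> (fourier_coeff v0) n" using Suc.IH by blast
    then show ?thesis by (intro ext) (simp add: scheme_step_def)
  qed
  moreover have "sobolev_le r (\<lambda>k. fourier_coeff ?w k + ?c * ?N k) (A + cmod ?c * B)"
    by (intro sobolev_le_add sobolev_le_scale w N)
  ultimately show ?case by metis
qed

theorem theorem2p3:
  fixes p :: nat and \<mu> T r \<gamma> :: real
  assumes "p \<ge> 1" and "T > 0"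
    and "r > real CARD('d::finite) / 2" and "0 < \<gamma>" and "\<gamma> \<le> 1"
  shows "\<exists>c :: real \<Rightarrow> real. \<forall>v :: real \<Rightarrow> real ^ 'd \<Rightarrow> complex.
    (\<forall>t\<in>{0..T}. v t \<in> sobolev_space (r + \<gamma>)) \<and>
    bdd_above ((\<lambda>t. sobolev_norm (r + \<gamma>) (v t)) ` {0..T}) \<and>
    mild_solution p \<mu> T v \<longrightarrow>
    (\<exists>\<tau>0>0. \<forall>\<tau> n. 0 < \<tau> \<and> \<tau> \<le> \<tau>0 \<and> real n * \<tau> \<le> T \<longrightarrow>
       low_reg_scheme p \<mu> \<tau> (v 0) n \<in> sobolev_space r \<and>
       sobolev_norm r (\<lambda>x. v (real n * \<tau>) x - low_reg_scheme p \<mu> \<tau> (v 0) n x)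
         \<le> c (SUP t\<in>{0..T}. sobolev_norm (r + \<gamma>) (v t)) * \<tau> powr \<gamma>)"
proof -
  obtain C K where lo: "sobolev_algebra_consts r C K TYPE('d)"
    using sobolev_algebra_consts_exist[OF assms(3)] by blast
  have "r + \<gamma> > real CARD('d) / 2" using assms by simp
  then obtain C' K' where hi: "sobolev_algebra_consts (r + \<gamma>) C' K' TYPE('d)"
    using sobolev_algebra_consts_exist by blast
  interpret sobolev_algebra_pair r C K \<gamma> C' K' "TYPE('d)"
    by unfold_locales (use lo hi assms in auto)
  have "\<forall>M. \<exists>c. \<forall>V :: real \<Rightarrow> int ^ 'd \<Rightarrow> complex.
     duhamel_solution p \<mu> T V \<and> (\<forall>s\<in>{0..T}. sobolev_le (r + \<gamma>) (V s) M) \<longrightarrow>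
     (\<exists>\<tau>0>0. \<forall>\<tau> n. 0 < \<tau> \<and> \<tau> \<le> \<tau>0 \<and> real n * \<tau> \<le> T \<longrightarrow>
        sobolev_le r (\<lambda>k. V (real n * \<tau>) k - scheme_seq p \<mu> \<tau> (V 0) n k) (c * \<tau> powr \<gamma>))"
    using scheme_convergence[OF \<open>T > 0\<close>, of p \<mu>] by blast
  \<comment> \<open>The constant may depend on the solution only through the bound M, so it is chosen before v is introduced.\<close>
  from choice[OF this] obtain c where c: "\<forall>M. \<forall>V :: real \<Rightarrow> int ^ 'd \<Rightarrow> complex.
     duhamel_solution p \<mu> T V \<and> (\<forall>s\<in>{0..T}. sobolev_le (r + \<gamma>) (V s) M) \<longrightarrow>
     (\<exists>\<tau>0>0. \<forall>\<tau> n. 0 < \<tau> \<and> \<tau> \<le> \<tau>0 \<and> real n * \<tau> \<le> T \<longrightarrow>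
        sobolev_le r (\<lambda>k. V (real n * \<tau>) k - scheme_seq p \<mu> \<tau> (V 0) n k) (c M * \<tau> powr \<gamma>))" ..
  show ?thesis
  proof (intro exI[of _ c] allI impI, elim conjE)
    fix v :: "real \<Rightarrow> real ^ 'd \<Rightarrow> complex"
    assume v: "\<forall>t\<in>{0..T}. v t \<in> sobolev_space (r + \<gamma>)"
      and bdd: "bdd_above ((\<lambda>t. sobolev_norm (r + \<gamma>) (v t)) ` {0..T})"
      and mild: "mild_solution p \<mu> T v"
    define M where "M = (SUP t\<in>{0..T}. sobolev_norm (r + \<gamma>) (v t))"
    have hiM: "sobolev_le (r + \<gamma>) (fourier_coeff (v t)) M" if "t \<in> {0..T}" for t
    proof (rule sobolev_le_mono[OF sobolev_le_sobolev_norm])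
      show "sobolev_norm (r + \<gamma>) (v t) \<le> M"
        unfolding M_def by (rule cSUP_upper[OF that bdd])
    qed (use v that in auto)
    have L2: "v t \<in> torus_L2" if "t \<in> {0..T}" for t
      using v that by (simp add: sobolev_space_def)
    have "duhamel_solution p \<mu> T (\<lambda>t. fourier_coeff (v t))"
      by (rule lo.mild_solution_duhamel[OF mild \<open>T > 0\<close> L2 lower[OF hiM]])
    with hiM c[rule_format, of "\<lambda>t. fourier_coeff (v t)" M] obtain \<tau>0 where \<tau>0: "\<tau>0 > 0"
      "\<And>\<tau> n. 0 < \<tau> \<Longrightarrow> \<tau> \<le> \<tau>0 \<Longrightarrow> real n * \<tau> \<le> T \<Longrightarrow>
        sobolev_le r (\<lambda>k. fourier_coeff (v (real n * \<tau>)) k - scheme_seq p \<mu> \<tau> (fourier_coeff (v 0)) n k) (c M * \<tau> powr \<gamma>)"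
      by blast
    show "\<exists>\<tau>0>0. \<forall>\<tau> n. 0 < \<tau> \<and> \<tau> \<le> \<tau>0 \<and> real n * \<tau> \<le> T \<longrightarrow>
       low_reg_scheme p \<mu> \<tau> (v 0) n \<in> sobolev_space r \<and>
       sobolev_norm r (\<lambda>x. v (real n * \<tau>) x - low_reg_scheme p \<mu> \<tau> (v 0) n x)
         \<le> c (SUP t\<in>{0..T}. sobolev_norm (r + \<gamma>) (v t)) * \<tau> powr \<gamma>"
      unfolding M_def[symmetric]
    proof (intro exI[of _ \<tau>0] conjI \<tau>0(1) allI impI; elim conjE)
      fix \<tau> n assume n: "0 < \<tau>" "\<tau> \<le> \<tau>0" "real n * \<tau> \<le> T"
      have "0 \<in> {0..T}" "real n * \<tau> \<in> {0..T}" using n \<open>T > 0\<close> by auto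
      note T = this
      let ?w = "low_reg_scheme p \<mu> \<tau> (v 0) n"
      have w: "?w \<in> torus_L2" "fourier_coeff ?w = scheme_seq p \<mu> \<tau> (fourier_coeff (v 0)) n"
        "\<exists>A. sobolev_le r (fourier_coeff ?w) A"
        using lo.low_reg_scheme_coeff[OF L2[OF T(1)] lower[OF hiM[OF T(1)]], of p \<mu> \<tau> n] by auto
      show "?w \<in> sobolev_space r"
        using w(1,3) sobolev_le_imp_sobolev_space by blast
      have "sobolev_le r (fourier_coeff (\<lambda>x. v (real n * \<tau>) x - ?w x)) (c M * \<tau> powr \<gamma>)"
        unfolding torus_L2_fourier_coeff_diff[OF L2[OF T(2)] w(1)] w(2) by (rule \<tau>0(2)[OF n])
      then show "sobolev_norm r (\<lambda>x. v (real n * \<tau>) x - ?w x) \<le> c M * \<tau> powr \<gamma>"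
        by (rule sobolev_le_imp_sobolev_norm_le)
    qed
  qed
qed

end
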